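(* Let $\omega$ be a non-quasianalytic weight function, i.e. $\int_1^\infty\frac{\omega(t)}{t^2}\,dt<+\infty$, and let $\sigma$ be a general weight function. Then the following are equivalent: (i) $\omega\preceq\sigma$, i.e. $\sigma(t)=O(\omega(t))$ as $t\to\infty$; (ii) $\mathcal{S}_{\{\omega\}}(\mathbb{R}^d)\subseteq\mathcal{S}_{\{\sigma\}}(\mathbb{R}^d)$ is valid for all $d\in\mathbb{N}$ with continuous inclusion. The spaces in (ii) can be defined by joint or separated growth at infinity, and (i)$\Rightarrow$(ii) is valid for general weight functions $\omega$ and $\sigma$. For (ii)$\Rightarrow$(i) only the inclusion for $d=1$ is required.
   Context: $\mathbb{N}_0=\mathbb{N}\cup\{0\}$. A weight function is a continuous increasing (i.e. nondecreasing) function $\omega:[0,+\infty)\to[0,+\infty)$ such that: $(\alpha)$ there is $L\ge 1$ with $\omega(2t)\le L(\omega(t)+1)$ for all $t\ge 0$; $(\beta)$ $\omega(t)=O(t^2)$ as $t\to+\infty$; $(\gamma)$ $\log t=o(\omega(t))$ as $t\to+\infty$; $(\delta)$ $\varphi_\omega(t):=\omega(e^t)$ is convex on $[0,+\infty)$. A general weight function satisfies all these properties except possibly $(\beta)$. The Young conjugate is $\varphi^*_\omega(s):=\sup_{t\ge 0}\{ts-\varphi_\omega(t)\}$, $s\ge 0$, and $W^{(\lambda)}_\alpha:=e^{\frac1\lambda\varphi^*_\omega(\lambda|\alpha|)}$ for $\lambda>0$, $\alpha\in\mathbb{N}_0^d$. $\mathcal{S}_{\{\omega\}}(\mathbb{R}^d)$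 is the space of all $f\in C^\infty(\mathbb{R}^d)$ for which there is $\lambda>0$ with $\sup_{\alpha,\beta\in\mathbb{N}_0^d}\|x^\alpha\partial^\beta f\|_\infty/W^{(\lambda)}_{\alpha+\beta}<\infty$, with the inductive limit topology over $\lambda$ ($\|\cdot\|_\infty$ is the supremum norm on $\mathbb{R}^d$). This is the definition by joint growth at infinity; in the definition by separated growth at infinity, $W^{(\lambda)}_{\alpha+\beta}$ is replaced by $W^{(\lambda)}_\alpha W^{(\lambda)}_\beta$. *)

theory Defs
  imports "HOL-Analysis.Analysis" "HOL-Library.Landau_Symbols"
begin

section \<open>Weight functions\<close>

text \<open>A weight function is a function on \<open>[0,\<infinity>)\<close>; the values of \<open>\<omega>\<close> at negative arguments are
  never used.\<close>

definition general_weight_function :: "(real \<Rightarrow> real) \<Rightarrow> bool" where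
  "general_weight_function \<omega> \<longleftrightarrow>
     continuous_on {0..} \<omega> \<and> mono_on {0..} \<omega> \<and> (\<forall>t\<ge>0. 0 \<le> \<omega> t) \<and>
     (\<exists>L\<ge>1. \<forall>t\<ge>0. \<omega> (2 * t) \<le> L * (\<omega> t + 1)) \<and>
     ln \<in> o[at_top](\<omega>) \<and>
     convex_on {0..} (\<lambda>t. \<omega> (exp t))"

definition weight_function :: "(real \<Rightarrow> real) \<Rightarrow> bool" where
  "weight_function \<omega> \<longleftrightarrow> general_weight_function \<omega> \<and> \<omega> \<in> O[at_top](\<lambda>t. t\<^sup>2)"

definition non_quasianalytic :: "(real \<Rightarrow> real) \<Rightarrow> bool" where
  "non_quasianalytic \<omega> \<longleftrightarrow> (\<integral>\<^sup>+ t\<in>{1..}. ennreal (\<omega> t / t\<^sup>2) \<partial>lborel) < \<infinity>"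

definition weight_preceq :: "(real \<Rightarrow> real) \<Rightarrow> (real \<Rightarrow> real) \<Rightarrow> bool"  (infix \<open>\<preceq>\<^sub>w\<close> 50) where
  "\<omega> \<preceq>\<^sub>w \<sigma> \<longleftrightarrow> \<sigma> \<in> O[at_top](\<omega>)"

text \<open>The supremum is over a set that is bounded above because \<open>ln t = o(\<omega> t)\<close>, so the real-valued
  \<open>SUP\<close> is the true one.\<close>

definition young_conjugate :: "(real \<Rightarrow> real) \<Rightarrow> real \<Rightarrow> real" where
  "young_conjugate \<omega> s = (SUP t\<in>{0..}. t * s - \<omega> (exp t))"

definition weight_matrix :: "(real \<Rightarrow> real) \<Rightarrow> real \<Rightarrow> nat \<Rightarrow> real" where
  "weight_matrix \<omega> \<mu> n = exp (young_conjugate \<omega> (\<mu> * real n) / \<mu>)"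


section \<open>Smooth functions on \<open>\<real>\<^sup>d\<close>\<close>

text \<open>The dimension \<open>d\<close> has to be quantified inside a formula, so points of \<open>\<real>\<^sup>d\<close> are the elements
  of \<^term>\<open>topspace (Euclidean_space d)\<close>, i.e. the sequences \<open>x\<close> with \<open>x i = 0\<close> for \<open>i \<ge> d\<close>.
  Likewise multi-indices are sequences of naturals vanishing from \<open>d\<close> on.\<close>

definition multi_indices :: "nat \<Rightarrow> (nat \<Rightarrow> nat) set" where
  "multi_indices d = {\<alpha>. \<forall>i\<ge>d. \<alpha> i = 0}"

definition multi_length :: "nat \<Rightarrow> (nat \<Rightarrow> nat) \<Rightarrow> nat" where
  "multi_length d \<alpha> = (\<Sum>i<d. \<alpha> i)"

definition monomial :: "nat \<Rightarrow> (nat \<Rightarrow> nat) \<Rightarrow> (nat \<Rightarrow> real) \<Rightarrow> real" where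
  "monomial d \<alpha> x = (\<Prod>i<d. x i ^ \<alpha> i)"

definition partial_deriv :: "nat \<Rightarrow> ((nat \<Rightarrow> real) \<Rightarrow> complex) \<Rightarrow> (nat \<Rightarrow> real) \<Rightarrow> complex" where
  "partial_deriv i f = (\<lambda>x. vector_derivative (\<lambda>t. f (x(i := t))) (at (x i)))"

definition multi_deriv ::
  "nat \<Rightarrow> (nat \<Rightarrow> nat) \<Rightarrow> ((nat \<Rightarrow> real) \<Rightarrow> complex) \<Rightarrow> (nat \<Rightarrow> real) \<Rightarrow> complex" where
  "multi_deriv d \<beta> f = foldr (\<lambda>i. partial_deriv i ^^ \<beta> i) [0..<d] f"

fun C_k :: "nat \<Rightarrow> nat \<Rightarrow> ((nat \<Rightarrow> real) \<Rightarrow> complex) \<Rightarrow> bool" where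
  "C_k d 0 f \<longleftrightarrow> continuous_map (Euclidean_space d) euclidean f"
| "C_k d (Suc k) f \<longleftrightarrow>
     continuous_map (Euclidean_space d) euclidean f \<and>
     (\<forall>i<d. (\<forall>x\<in>topspace (Euclidean_space d). (\<lambda>t. f (x(i := t))) differentiable at (x i)) \<and>
            C_k d k (partial_deriv i f))"

text \<open>The values outside \<open>\<real>\<^sup>d\<close> are fixed to be \<open>0\<close>, so that an element of \<open>C\<^sup>\<infinity>(\<real>\<^sup>d)\<close> is determined
  by its restriction to \<open>\<real>\<^sup>d\<close> and pointwise operations stay inside the space.\<close>

definition C_infinity :: "nat \<Rightarrow> ((nat \<Rightarrow> real) \<Rightarrow> complex) set" where
  "C_infinity d =
     {f. (\<forall>k. C_k d k f) \<and> (\<forall>x. x \<notin> topspace (Euclidean_space d) \<longrightarrow> f x = 0)}"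

definition sup_norm :: "nat \<Rightarrow> ((nat \<Rightarrow> real) \<Rightarrow> complex) \<Rightarrow> ennreal" where
  "sup_norm d g = (SUP x\<in>topspace (Euclidean_space d). ennreal (cmod (g x)))"


section \<open>Locally convex inductive limits of function spaces\<close>

definition seminorm_topology ::
  "('a \<Rightarrow> complex) set \<Rightarrow> (('a \<Rightarrow> complex) \<Rightarrow> ennreal) \<Rightarrow> ('a \<Rightarrow> complex) topology" where
  "seminorm_topology E p = topology (\<lambda>U. U \<subseteq> E \<and>
     (\<forall>f\<in>U. \<exists>\<epsilon>>0. \<forall>g\<in>E. p (\<lambda>x. g x - f x) < \<epsilon> \<longrightarrow> g \<in> U))"

lemma openin_seminorm_topology:
  "openin (seminorm_topology E p) U \<longleftrightarrow>
     U \<subseteq> E \<and> (\<forall>f\<in>U. \<exists>\<epsilon>>0. \<forall>g\<in>E. p (\<lambda>x. g x - f x) < \<epsilon> \<longrightarrow> g \<in> U)"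
proof -
  have "istopology (\<lambda>U. U \<subseteq> E \<and> (\<forall>f\<in>U. \<exists>\<epsilon>>0. \<forall>g\<in>E. p (\<lambda>x. g x - f x) < \<epsilon> \<longrightarrow> g \<in> U))"
    (is "istopology ?P")
    unfolding istopology_def
  proof (intro conjI allI impI)
    fix S T assume S: "?P S" and T: "?P T"
    show "S \<inter> T \<subseteq> E" using S by blast
    show "\<forall>f\<in>S \<inter> T. \<exists>\<epsilon>>0. \<forall>g\<in>E. p (\<lambda>x. g x - f x) < \<epsilon> \<longrightarrow> g \<in> S \<inter> T"
    proof
      fix f assume f: "f \<in> S \<inter> T"
      from f S obtain a where a: "a > 0" "\<forall>g\<in>E. p (\<lambda>x. g x - f x) < a \<longrightarrow> g \<in> S"
        by blast
      from f T obtain b where b: "b > 0" "\<forall>g\<in>E. p (\<lambda>x. g x - f x) < b \<longrightarrow> g \<in> T"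
        by blast
      have "min a b > 0" using a(1) b(1) by simp
      moreover have "\<forall>g\<in>E. p (\<lambda>x. g x - f x) < min a b \<longrightarrow> g \<in> S \<inter> T"
        using a(2) b(2) by simp
      ultimately show "\<exists>\<epsilon>>0. \<forall>g\<in>E. p (\<lambda>x. g x - f x) < \<epsilon> \<longrightarrow> g \<in> S \<inter> T" by blast
    qed
  next
    fix K assume K: "\<forall>S\<in>K. ?P S"
    show "\<Union>K \<subseteq> E" using K by blast
    show "\<forall>f\<in>\<Union>K. \<exists>\<epsilon>>0. \<forall>g\<in>E. p (\<lambda>x. g x - f x) < \<epsilon> \<longrightarrow> g \<in> \<Union>K"
    proof
      fix f assume "f \<in> \<Union>K"
      then obtain S where S: "S \<in> K" "f \<in> S" by blast
      then obtain \<epsilon> where "\<epsilon> > 0" "\<forall>g\<in>E. p (\<lambda>x. g x - f x) < \<epsilon> \<longrightarrow> g \<in> S"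
        using K by blast
      with S show "\<exists>\<epsilon>>0. \<forall>g\<in>E. p (\<lambda>x. g x - f x) < \<epsilon> \<longrightarrow> g \<in> \<Union>K" by blast
    qed
  qed
  then show ?thesis
    unfolding seminorm_topology_def by (simp only: topology_inverse')
qed

definition locally_convex_topology ::
  "('a \<Rightarrow> complex) set \<Rightarrow> ('a \<Rightarrow> complex) topology \<Rightarrow> bool" where
  "locally_convex_topology E T \<longleftrightarrow>
     topspace T = E \<and>
     continuous_map (prod_topology T T) T (\<lambda>(f, g). (\<lambda>x. f x + g x)) \<and>
     continuous_map (prod_topology euclidean T) T (\<lambda>(c, f). (\<lambda>x. c * f x)) \<and>
     (\<forall>U. openin T U \<and> (\<lambda>_. 0) \<in> U \<longrightarrow>
        (\<exists>C V. openin T V \<and> (\<lambda>_. 0) \<in> V \<and> V \<subseteq> C \<and> C \<subseteq> U \<and>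
           (\<forall>f\<in>C. \<forall>g\<in>C. \<forall>t::real. 0 \<le> t \<and> t \<le> 1 \<longrightarrow>
              (\<lambda>x. of_real (1 - t) * f x + of_real t * g x) \<in> C)))"

text \<open>The inductive limit topology on the vector space \<open>E\<close> of a family of topologized subspaces is
  the finest locally convex topology for which all the inclusions into \<open>E\<close> are continuous, that is,
  the supremum of all the locally convex topologies with this property.\<close>

definition inductive_limit_topology ::
  "('a \<Rightarrow> complex) set \<Rightarrow> ('a \<Rightarrow> complex) topology set \<Rightarrow> ('a \<Rightarrow> complex) topology" where
  "inductive_limit_topology E \<S> =
     topology_generated_by
       {U. \<exists>T. locally_convex_topology E T \<and>
               (\<forall>S\<in>\<S>. continuous_map S T (\<lambda>f. f)) \<and> openin T U}"


section \<open>The spaces \<open>\<S>\<^bsub>{\<omega>}\<^esub>(\<real>\<^sup>d)\<close>\<close>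

datatype growth = Joint | Separated

fun growth_weight ::
  "growth \<Rightarrow> (real \<Rightarrow> real) \<Rightarrow> nat \<Rightarrow> real \<Rightarrow> (nat \<Rightarrow> nat) \<Rightarrow> (nat \<Rightarrow> nat) \<Rightarrow> real" where
  "growth_weight Joint \<omega> d \<mu> \<alpha> \<beta> = weight_matrix \<omega> \<mu> (multi_length d (\<lambda>i. \<alpha> i + \<beta> i))"
| "growth_weight Separated \<omega> d \<mu> \<alpha> \<beta> =
     weight_matrix \<omega> \<mu> (multi_length d \<alpha>) * weight_matrix \<omega> \<mu> (multi_length d \<beta>)"

definition GS_norm ::
  "growth \<Rightarrow> (real \<Rightarrow> real) \<Rightarrow> nat \<Rightarrow> real \<Rightarrow> ((nat \<Rightarrow> real) \<Rightarrow> complex) \<Rightarrow> ennreal" where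
  "GS_norm G \<omega> d \<mu> f =
     (SUP \<alpha>\<in>multi_indices d. SUP \<beta>\<in>multi_indices d.
        sup_norm d (\<lambda>x. of_real (monomial d \<alpha> x) * multi_deriv d \<beta> f x)
          / ennreal (growth_weight G \<omega> d \<mu> \<alpha> \<beta>))"

definition GS_step ::
  "growth \<Rightarrow> (real \<Rightarrow> real) \<Rightarrow> nat \<Rightarrow> real \<Rightarrow> ((nat \<Rightarrow> real) \<Rightarrow> complex) set" where
  "GS_step G \<omega> d \<mu> = {f \<in> C_infinity d. GS_norm G \<omega> d \<mu> f < \<infinity>}"

definition GS_space ::
  "growth \<Rightarrow> (real \<Rightarrow> real) \<Rightarrow> nat \<Rightarrow> ((nat \<Rightarrow> real) \<Rightarrow> complex) set" where
  "GS_space G \<omega> d = (\<Union>\<mu>\<in>{0<..}. GS_step G \<omega> d \<mu>)"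

definition GS_topology ::
  "growth \<Rightarrow> (real \<Rightarrow> real) \<Rightarrow> nat \<Rightarrow> ((nat \<Rightarrow> real) \<Rightarrow> complex) topology" where
  "GS_topology G \<omega> d =
     inductive_limit_topology (GS_space G \<omega> d)
       {seminorm_topology (GS_step G \<omega> d \<mu>) (GS_norm G \<omega> d \<mu>) | \<mu>. \<mu> > 0}"

end

theory Submission
  imports Defs
begin

text \<open>
  From weights to spaces: an estimate \<open>\<sigma> \<le> C \<omega> + C\<close> passes to the Young conjugates and says that the
  weight matrix of \<open>\<omega>\<close> with parameter \<open>\<mu>\<close> is dominated by that of \<open>\<sigma>\<close> with parameter \<open>C \<mu>\<close>
  (\<open>weight_matrix_dominated\<close>). Because the conjugate is convex and nonpositive at \<open>0\<close>, the
  weight matrices are supermultiplicative, and submultiplicative after doubling the parameter. This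
  makes joint and separated growth interchangeable (\<open>growth_weight_dominated\<close>), so every step of
  one space is contained in a step of the other with an estimate of the norms. The inclusion of
  the inductive limits is then continuous, because a locally convex topology on the larger space
  restricts to one on the smaller space (\<open>continuous_map_inductive_limit_inclusion\<close>).

  From spaces to weights: it suffices to exhibit one function of one variable in the smaller space
  whose membership in the larger space already forces \<open>\<sigma> = O(\<omega>)\<close>. It is a superposition of
  modulated Gaussians
    \<open>f(x) = \<Sum>\<^sub>n c\<^sub>n exp(i n x - x\<^sup>2 / 2)\<close>, with \<open>c\<^sub>n = e\<^bsup>-\<omega>(n)/\<mu>\<^esup> / n\<^sup>2\<close>.
  Since \<open>\<omega>(t) = O(t\<^sup>2)\<close>, the moments of the Gaussian are controlled by the weight matrix, and the
  recursion for the derivatives of a modulated Gaussian gives the bounds for \<open>f\<close>; the geometric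
  factors that arise are absorbed by condition \<open>(\<alpha>)\<close>. On the other hand the \<open>k\<close>-th derivative at
  \<open>0\<close> of \<open>exp(i n x - x\<^sup>2 / 2)\<close> equals \<open>i\<^sup>k\<close> times a real number that is at least \<open>n\<^sup>k\<close>. So nothing cancels and
  \<open>\<bar>f\<^sup>(\<^sup>k\<^sup>)(0)\<bar> \<ge> c\<^sub>m m\<^sup>k\<close> for all \<open>m\<close> and \<open>k\<close> (\<open>exists_test_function\<close>). If \<open>f\<close> belongs to the space of \<open>\<sigma>\<close>, these derivatives
  are bounded by the weight matrix of \<open>\<sigma>\<close>; taking the conjugate once more
  (\<open>weight_le_of_moment_bounds\<close>) yields \<open>\<sigma>(m) \<le> \<kappa> ln m + \<kappa> ln (N / c\<^sub>m)\<close>, which is at most a multiple of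
  \<open>\<omega>(m) + 1\<close>. Monotonicity and condition \<open>(\<alpha>)\<close> extend the estimate from integers to all arguments.
\<close>

section \<open>Young conjugates and weight matrices\<close>

lemma general_weight_functionD:
  assumes "general_weight_function \<omega>"
  shows "\<And>s t. 0 \<le> s \<Longrightarrow> s \<le> t \<Longrightarrow> \<omega> s \<le> \<omega> t"
    and "\<And>t. 0 \<le> t \<Longrightarrow> 0 \<le> \<omega> t"
    and "ln \<in> o[at_top](\<omega>)"
    and "convex_on {0..} (\<lambda>t. \<omega> (exp t))"
    and "\<exists>L\<ge>1. \<forall>t\<ge>0. \<omega> (2 * t) \<le> L * (\<omega> t + 1)"
  using assms unfolding general_weight_function_def by (auto simp: mono_on_def)

lemma ln_le_weight:
  assumes \<omega>: "general_weight_function \<omega>" and "\<epsilon> > 0"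
  shows "\<exists>C\<ge>0. \<forall>t\<ge>1. ln t \<le> \<epsilon> * \<omega> t + C"
proof -
  have "eventually (\<lambda>t. norm (ln t) \<le> \<epsilon> * norm (\<omega> t)) at_top"
    using general_weight_functionD(3)[OF \<omega>] \<open>\<epsilon> > 0\<close> by (rule landau_o.smallD)
  then obtain N where N: "\<And>t. t \<ge> N \<Longrightarrow> norm (ln t) \<le> \<epsilon> * norm (\<omega> t)"
    unfolding eventually_at_top_linorder by blast
  define T where "T = max 1 N"
  have "ln t \<le> \<epsilon> * \<omega> t + ln T" if t: "t \<ge> 1" for t
  proof (cases "t \<ge> T")
    case True
    then have "ln t \<le> \<epsilon> * \<omega> t"
      using N[of t] general_weight_functionD(2)[OF \<omega>, of t] t by (simp add: T_def)
    moreover have "0 \<le> ln T" by (simp add: T_def)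
    ultimately show ?thesis by linarith
  next
    case False
    then have "ln t \<le> ln T" using t by simp
    moreover have "0 \<le> \<epsilon> * \<omega> t"
      using general_weight_functionD(2)[OF \<omega>, of t] t \<open>\<epsilon> > 0\<close> by simp
    ultimately show ?thesis by linarith
  qed
  moreover have "0 \<le> ln T" by (simp add: T_def)
  ultimately show ?thesis by blast
qed

lemma young_conjugate_upper:
  assumes \<omega>: "general_weight_function \<omega>" and t: "t \<ge> 0"
  shows "t * s - \<omega> (exp t) \<le> young_conjugate \<omega> s"
proof -
  have "\<exists>B. \<forall>u\<ge>0. u * s - \<omega> (exp u) \<le> B"
  proof (cases "s > 0")
    case True
    then obtain C where C: "\<And>u. u \<ge> 1 \<Longrightarrow> ln u \<le> (1 / s) * \<omega> u + C"
      using ln_le_weight[OF \<omega>, of "1 / s"] by auto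
    have "u * s - \<omega> (exp u) \<le> C * s" if "u \<ge> 0" for u
      using C[of "exp u"] that True by (simp add: field_simps)
    then show ?thesis by blast
  next
    case False
    have "u * s - \<omega> (exp u) \<le> 0" if "u \<ge> 0" for u
      using mult_nonneg_nonpos[of u s] that False general_weight_functionD(2)[OF \<omega>, of "exp u"]
      by simp
    then show ?thesis by blast
  qed
  then have "bdd_above ((\<lambda>t. t * s - \<omega> (exp t)) ` {0..})"
    by (auto simp: bdd_above_def)
  then show ?thesis
    unfolding young_conjugate_def using t by (intro cSUP_upper) auto
qed

lemma young_conjugate_least:
  assumes "\<And>t. t \<ge> 0 \<Longrightarrow> t * s - \<omega> (exp t) \<le> B"
  shows "young_conjugate \<omega> s \<le> B"
  unfolding young_conjugate_def using assms by (intro cSUP_least) auto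

lemma young_conjugate_mono:
  assumes \<omega>: "general_weight_function \<omega>" and "r \<le> s"
  shows "young_conjugate \<omega> r \<le> young_conjugate \<omega> s"
proof (rule young_conjugate_least)
  fix t :: real assume t: "t \<ge> 0"
  have "t * r \<le> t * s" using t assms(2) by (intro mult_left_mono)
  then show "t * r - \<omega> (exp t) \<le> young_conjugate \<omega> s"
    using young_conjugate_upper[OF \<omega> t, of s] by linarith
qed

lemma young_conjugate_convex:
  assumes \<omega>: "general_weight_function \<omega>" and "u \<ge> 0" "v \<ge> 0" "u + v = 1"
  shows "young_conjugate \<omega> (u * r + v * s) \<le> u * young_conjugate \<omega> r + v * young_conjugate \<omega> s"
proof (rule young_conjugate_least)
  fix t :: real assume t: "t \<ge> 0"
  have "t * (u * r + v * s) - \<omega> (exp t) = u * (t * r - \<omega> (exp t)) + v * (t * s - \<omega> (exp t))"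
    using arg_cong[OF assms(4), of "\<lambda>c. c * \<omega> (exp t)"] by (simp add: algebra_simps)
  also have "\<dots> \<le> u * young_conjugate \<omega> r + v * young_conjugate \<omega> s"
    using assms(2,3) young_conjugate_upper[OF \<omega> t] by (intro add_mono mult_left_mono) auto
  finally show "t * (u * r + v * s) - \<omega> (exp t) \<le> \<dots>" .
qed

lemma young_conjugate_0:
  assumes "general_weight_function \<omega>"
  shows "young_conjugate \<omega> 0 \<le> 0"
  using general_weight_functionD(2)[OF assms] by (intro young_conjugate_least) auto

text \<open>A convex function that is nonpositive at the origin is superadditive: both summands lie
  on the segment from \<open>0\<close> to the sum.\<close>

lemma young_conjugate_superadditive:
  assumes \<omega>: "general_weight_function \<omega>" and "r \<ge> 0" "s \<ge> 0"
  shows "young_conjugate \<omega> r + young_conjugate \<omega> s \<le> young_conjugate \<omega> (r + s)"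
proof (cases "r + s = 0")
  case True
  then have "r = 0" "s = 0" using assms by linarith+
  then show ?thesis using young_conjugate_0[OF \<omega>] by simp
next
  case False
  then have pos: "r + s > 0" using assms by linarith
  have scale: "young_conjugate \<omega> (q * (r + s)) \<le> q * young_conjugate \<omega> (r + s)"
    if "0 \<le> q" "q \<le> 1" for q
    using young_conjugate_convex[OF \<omega>, of q "1 - q" "r + s" 0] that
      mult_nonneg_nonpos[of "1 - q", OF _ young_conjugate_0[OF \<omega>]] by simp
  have "young_conjugate \<omega> r \<le> r / (r + s) * young_conjugate \<omega> (r + s)"
    using scale[of "r / (r + s)"] pos assms by simp
  moreover have "young_conjugate \<omega> s \<le> s / (r + s) * young_conjugate \<omega> (r + s)"
    using scale[of "s / (r + s)"] pos assms by simp
  moreover have "r / (r + s) * young_conjugate \<omega> (r + s) + s / (r + s) * young_conjugate \<omega> (r + s)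
      = young_conjugate \<omega> (r + s)"
    using pos by (simp flip: distrib_right add_divide_distrib)
  ultimately show ?thesis by linarith
qed

lemma weight_matrix_pos: "weight_matrix \<omega> \<mu> n > 0"
  by (simp add: weight_matrix_def)

lemma weight_matrix_supermult:
  assumes \<omega>: "general_weight_function \<omega>" and \<mu>: "\<mu> > 0"
  shows "weight_matrix \<omega> \<mu> m * weight_matrix \<omega> \<mu> n \<le> weight_matrix \<omega> \<mu> (m + n)"
  using young_conjugate_superadditive[OF \<omega>, of "\<mu> * m" "\<mu> * n"] \<mu>
  by (simp add: weight_matrix_def distrib_left divide_right_mono flip: exp_add add_divide_distrib)

lemma weight_matrix_submult:
  assumes \<omega>: "general_weight_function \<omega>" and \<mu>: "\<mu> > 0"
  shows "weight_matrix \<omega> \<mu> (m + n) \<le> weight_matrix \<omega> (2 * \<mu>) m * weight_matrix \<omega> (2 * \<mu>) n"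
proof -
  have "young_conjugate \<omega> (\<mu> * (m + n))
      \<le> young_conjugate \<omega> (2 * \<mu> * m) / 2 + young_conjugate \<omega> (2 * \<mu> * n) / 2"
    using young_conjugate_convex[OF \<omega>, of "1/2" "1/2" "2 * \<mu> * m" "2 * \<mu> * n"]
    by (simp add: algebra_simps)
  then show ?thesis
    using \<mu> by (simp add: weight_matrix_def field_simps flip: exp_add)
qed

lemma power_le_weight_matrix:
  assumes \<omega>: "general_weight_function \<omega>" and \<mu>: "\<mu> > 0" and r: "r \<ge> 1"
  shows "r ^ n \<le> exp (\<omega> r / \<mu>) * weight_matrix \<omega> \<mu> n"
proof -
  have "ln r * (\<mu> * n) - \<omega> r \<le> young_conjugate \<omega> (\<mu> * n)"
    using young_conjugate_upper[OF \<omega>, of "ln r" "\<mu> * n"] r by simp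
  then have "n * ln r \<le> \<omega> r / \<mu> + young_conjugate \<omega> (\<mu> * n) / \<mu>"
    using \<mu> by (simp add: field_simps)
  then have "exp (n * ln r) \<le> exp (\<omega> r / \<mu> + young_conjugate \<omega> (\<mu> * n) / \<mu>)"
    by simp
  then show ?thesis
    using r by (simp add: weight_matrix_def exp_of_nat_mult exp_add)
qed

text \<open>If \<open>\<sigma> \<le> C \<omega> + C\<close> then \<open>\<phi>\<^sub>\<sigma>\<^sup>*(s) \<ge> C \<phi>\<^sub>\<omega>\<^sup>*(s / C) - C\<close>; the factor \<open>C\<close> is absorbed by the
  parameter of the weight matrix.\<close>

lemma weight_matrix_dominated:
  assumes \<sigma>: "general_weight_function \<sigma>" and \<mu>: "\<mu> > 0" and C: "C > 0"
    and le: "\<And>t. t \<ge> 1 \<Longrightarrow> \<sigma> t \<le> C * \<omega> t + C"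
  shows "weight_matrix \<omega> \<mu> n \<le> exp (1 / \<mu>) * weight_matrix \<sigma> (C * \<mu>) n"
proof -
  let ?B = "young_conjugate \<sigma> (C * \<mu> * n)"
  have "young_conjugate \<omega> (\<mu> * n) \<le> ?B / C + 1"
  proof (rule young_conjugate_least)
    fix t :: real assume t: "t \<ge> 0"
    have "t * (C * \<mu> * n) - (C * \<omega> (exp t) + C) \<le> ?B"
      using young_conjugate_upper[OF \<sigma> t, of "C * \<mu> * n"] le[of "exp t"] t by simp
    then show "t * (\<mu> * n) - \<omega> (exp t) \<le> ?B / C + 1"
      using C by (simp add: field_simps)
  qed
  then have "young_conjugate \<omega> (\<mu> * n) / \<mu> \<le> 1 / \<mu> + ?B / (C * \<mu>)"
    using \<mu> C by (simp add: field_simps)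
  then show ?thesis
    by (simp add: weight_matrix_def flip: exp_add)
qed

text \<open>Condition \<open>(\<alpha>)\<close> says that \<open>\<phi>\<^sub>\<omega>\<close> shifted by \<open>ln 2\<close> is at most \<open>L \<phi>\<^sub>\<omega> + L\<close>. On the side
  of the conjugate the shift becomes the linear term that produces the geometric factor.\<close>

lemma weight_matrix_absorbs_power_of_2:
  assumes \<omega>: "general_weight_function \<omega>"
  shows "\<exists>L>0. \<forall>\<mu>>0. \<forall>n. 2 ^ n * weight_matrix \<omega> \<mu> n \<le> exp (1 / \<mu>) * weight_matrix \<omega> (L * \<mu>) n"
proof -
  obtain L where L: "L \<ge> 1" and dbl: "\<And>t. t \<ge> 0 \<Longrightarrow> \<omega> (2 * t) \<le> L * (\<omega> t + 1)"
    using general_weight_functionD(5)[OF \<omega>] by auto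
  have "2 ^ n * weight_matrix \<omega> \<mu> n \<le> exp (1 / \<mu>) * weight_matrix \<omega> (L * \<mu>) n"
    if \<mu>: "\<mu> > 0" for \<mu> n
  proof -
    let ?B = "young_conjugate \<omega> (L * \<mu> * n)"
    have "young_conjugate \<omega> (\<mu> * n) \<le> ?B / L + 1 - \<mu> * n * ln 2"
    proof (rule young_conjugate_least)
      fix t :: real assume t: "t \<ge> 0"
      have "(t + ln 2) * (L * \<mu> * n) - \<omega> (2 * exp t) \<le> ?B"
        using young_conjugate_upper[OF \<omega>, of "t + ln 2" "L * \<mu> * n"] t
        by (simp add: exp_add mult.commute)
      then have "(t + ln 2) * (L * \<mu> * n) - L * (\<omega> (exp t) + 1) \<le> ?B"
        using dbl[of "exp t"] by simp
      then show "t * (\<mu> * n) - \<omega> (exp t) \<le> ?B / L + 1 - \<mu> * n * ln 2"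
        using L by (simp add: field_simps)
    qed
    then have "young_conjugate \<omega> (\<mu> * n) / \<mu> \<le> (?B / L + 1 - \<mu> * n * ln 2) / \<mu>"
      using \<mu> by (intro divide_right_mono) auto
    also have "\<dots> = ?B / (L * \<mu>) + 1 / \<mu> - n * ln 2"
      using \<mu> by (simp add: add_divide_distrib diff_divide_distrib)
    finally have "n * ln 2 + young_conjugate \<omega> (\<mu> * n) / \<mu> \<le> 1 / \<mu> + ?B / (L * \<mu>)"
      by linarith
    then have "exp (n * ln 2 + young_conjugate \<omega> (\<mu> * n) / \<mu>) \<le> exp (1 / \<mu> + ?B / (L * \<mu>))"
      by simp
    then show ?thesis
      by (simp add: weight_matrix_def exp_add exp_of_nat_mult)
  qed
  then show ?thesis using L by (intro exI[of _ L]) auto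
qed

text \<open>A bound near infinity extends to \<open>[1, \<infinity>)\<close> at the price of an additive constant because \<open>\<sigma>\<close> is
  monotone. Conversely the additive constant is absorbed because \<open>\<omega>\<close> outgrows the logarithm and so
  tends to infinity.\<close>

lemma weight_preceq_iff:
  assumes \<omega>: "general_weight_function \<omega>" and \<sigma>: "general_weight_function \<sigma>"
  shows "\<omega> \<preceq>\<^sub>w \<sigma> \<longleftrightarrow> (\<exists>C>0. \<forall>t\<ge>1. \<sigma> t \<le> C * \<omega> t + C)"
proof
  assume "\<omega> \<preceq>\<^sub>w \<sigma>"
  then obtain c where c: "c > 0" and "eventually (\<lambda>t. norm (\<sigma> t) \<le> c * norm (\<omega> t)) at_top"
    unfolding weight_preceq_def by (auto elim: landau_o.bigE)
  then obtain N where N: "\<And>t. t \<ge> N \<Longrightarrow> norm (\<sigma> t) \<le> c * norm (\<omega> t)"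
    unfolding eventually_at_top_linorder by blast
  define T where "T = max 1 N"
  have T: "T \<ge> 1" "T \<ge> N" "\<sigma> T \<ge> 0"
    using general_weight_functionD(2)[OF \<sigma>, of T] by (auto simp: T_def)
  have "\<sigma> t \<le> (c + \<sigma> T) * \<omega> t + (c + \<sigma> T)" if t: "t \<ge> 1" for t
  proof -
    have "\<sigma> t \<le> c * \<omega> t + \<sigma> T"
    proof (cases "t \<ge> T")
      case True
      then show ?thesis
        using N[of t] T t general_weight_functionD(2)[OF \<omega>, of t] by simp
    next
      case False
      have "0 \<le> c * \<omega> t" using c t general_weight_functionD(2)[OF \<omega>, of t] by simp
      then show ?thesis
        using general_weight_functionD(1)[OF \<sigma>, of t T] False t by linarith
    qed
    moreover have "0 \<le> \<sigma> T * \<omega> t" using T t general_weight_functionD(2)[OF \<omega>, of t] by simp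
    ultimately show ?thesis using c by (simp add: algebra_simps)
  qed
  moreover have "c + \<sigma> T > 0" using c T by linarith
  ultimately show "\<exists>C>0. \<forall>t\<ge>1. \<sigma> t \<le> C * \<omega> t + C" by blast
next
  assume "\<exists>C>0. \<forall>t\<ge>1. \<sigma> t \<le> C * \<omega> t + C"
  then obtain C where C: "C > 0" "\<And>t. t \<ge> 1 \<Longrightarrow> \<sigma> t \<le> C * \<omega> t + C" by blast
  obtain A where A: "A \<ge> 0" "\<And>t. t \<ge> 1 \<Longrightarrow> ln t \<le> \<omega> t + A"
    using ln_le_weight[OF \<omega>, of 1] by auto
  have "eventually (\<lambda>t. norm (\<sigma> t) \<le> (2 * C) * norm (\<omega> t)) at_top"
    using eventually_ge_at_top[of "exp (A + 1)"]
  proof eventually_elim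
    case (elim t)
    have "t > 0" using elim exp_gt_zero[of "A + 1"] by linarith
    then have "A + 1 \<le> ln t" using elim by (simp add: ln_ge_iff)
    moreover have t: "t \<ge> 1" using elim one_le_exp_iff[of "A + 1"] A by linarith
    ultimately have "1 \<le> \<omega> t" using A(2)[of t] by linarith
    then have "C * \<omega> t + C \<le> 2 * C * \<omega> t" using C(1) by simp
    then show ?case
      using C(2)[OF t] general_weight_functionD(2)[OF \<omega>, of t]
        general_weight_functionD(2)[OF \<sigma>, of t] t by simp
  qed
  then show "\<omega> \<preceq>\<^sub>w \<sigma>" unfolding weight_preceq_def by (rule bigoI)
qed

text \<open>The other half of biconjugation, with integer moments only. Convexity provides a slope
  \<open>s\<close> at \<open>ln r\<close> for which \<open>\<phi>\<^sub>\<sigma>\<^sup>*(s) = s ln r - \<sigma>(r)\<close>. Rounding \<open>s / \<mu>\<close> down to an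
  integer \<open>n\<close> changes \<open>s ln r\<close> by at most \<open>\<mu> ln r\<close>.\<close>

lemma weight_le_of_moment_bounds:
  assumes \<sigma>: "general_weight_function \<sigma>" and \<mu>: "\<mu> > 0" and r: "r \<ge> 1" and K: "K > 0"
    and le: "\<And>n. r ^ n \<le> K * weight_matrix \<sigma> \<mu> n"
  shows "\<sigma> r \<le> \<mu> * ln r + \<mu> * ln K"
proof -
  define \<phi> where "\<phi> = (\<lambda>t. \<sigma> (exp t))"
  define t where "t = ln r"
  have t: "t \<ge> 0" "exp t = r" using r by (auto simp: t_def)
  have "\<exists>s\<ge>0. \<forall>u\<ge>0. \<phi> t + s * (u - t) \<le> \<phi> u"
  proof (cases "t = 0")
    case True
    then show ?thesis
      using general_weight_functionD(1)[OF \<sigma>, of 1] by (intro exI[of _ 0]) (auto simp: \<phi>_def)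
  next
    case False
    then have tpos: "t > 0" using t by simp
    define s where "s = Inf ((\<lambda>u. (\<phi> t - \<phi> u) / (t - u)) ` ({t<..} \<inter> {0..}))"
    have "convex_on {0..} \<phi>" unfolding \<phi>_def by (rule general_weight_functionD(4)[OF \<sigma>])
    then have sub: "\<phi> t + s * (u - t) \<le> \<phi> u" if "u \<ge> 0" for u
      unfolding s_def using that tpos by (intro convex_le_Inf_differential) auto
    have "\<phi> 0 \<le> \<phi> t"
      using general_weight_functionD(1)[OF \<sigma>, of 1 r] r t by (simp add: \<phi>_def)
    then have "0 \<le> s * t" using sub[of 0] by simp
    then have "s \<ge> 0" using tpos by (simp add: zero_le_mult_iff)
    then show ?thesis using sub by blast
  qed
  then obtain s where s: "s \<ge> 0" and sub: "\<And>u. u \<ge> 0 \<Longrightarrow> \<phi> t + s * (u - t) \<le> \<phi> u" by blast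
  define n where "n = nat \<lfloor>s / \<mu>\<rfloor>"
  have "real n = of_int \<lfloor>s / \<mu>\<rfloor>" unfolding n_def using s \<mu> by simp
  then have "real n \<le> s / \<mu>" "s / \<mu> < real n + 1" by linarith+
  then have n: "\<mu> * n \<le> s" "s \<le> \<mu> * n + \<mu>" using \<mu> by (auto simp: field_simps)
  have "young_conjugate \<sigma> (\<mu> * n) \<le> young_conjugate \<sigma> s"
    by (rule young_conjugate_mono[OF \<sigma> n(1)])
  also have "\<dots> \<le> s * t - \<phi> t"
    using sub by (intro young_conjugate_least) (simp add: \<phi>_def algebra_simps)
  finally have yc: "young_conjugate \<sigma> (\<mu> * n) \<le> s * t - \<phi> t" .
  have "ln (r ^ n) \<le> ln (K * weight_matrix \<sigma> \<mu> n)"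
    using le[of n] r K weight_matrix_pos[of \<sigma> \<mu> n] by simp
  then have "n * t \<le> ln K + young_conjugate \<sigma> (\<mu> * n) / \<mu>"
    using r K by (simp add: t_def ln_realpow ln_mult weight_matrix_def)
  then have "\<mu> * n * t \<le> \<mu> * ln K + young_conjugate \<sigma> (\<mu> * n)"
    using \<mu> by (simp add: field_simps)
  moreover have "s * t \<le> (\<mu> * n + \<mu>) * t" using n t by (intro mult_right_mono)
  ultimately have "\<phi> t \<le> \<mu> * t + \<mu> * ln K" using yc by (simp add: algebra_simps)
  then show ?thesis by (simp add: \<phi>_def t t_def[symmetric])
qed

section \<open>Inclusions between inductive limits\<close>

definition function_subspace :: "('a \<Rightarrow> complex) set \<Rightarrow> bool" where
  "function_subspace E \<longleftrightarrow> (\<lambda>_. 0) \<in> E \<and>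
     (\<forall>f\<in>E. \<forall>g\<in>E. (\<lambda>x. f x + g x) \<in> E) \<and> (\<forall>c. \<forall>f\<in>E. (\<lambda>x. c * f x) \<in> E)"

lemma function_subspaceD:
  assumes "function_subspace E"
  shows "(\<lambda>_. 0) \<in> E"
    and "\<And>f g. f \<in> E \<Longrightarrow> g \<in> E \<Longrightarrow> (\<lambda>x. f x + g x) \<in> E"
    and "\<And>c f. f \<in> E \<Longrightarrow> (\<lambda>x. c * f x) \<in> E"
  using assms unfolding function_subspace_def by auto

lemma topspace_seminorm_topology: "topspace (seminorm_topology E p) = E"
proof
  have "openin (seminorm_topology E p) E"
    unfolding openin_seminorm_topology
  proof (intro conjI ballI)
    fix f assume "f \<in> E"
    show "\<exists>\<epsilon>>0. \<forall>g\<in>E. p (\<lambda>x. g x - f x) < \<epsilon> \<longrightarrow> g \<in> E"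
      by (rule exI[of _ 1]) simp
  qed simp
  then show "E \<subseteq> topspace (seminorm_topology E p)" by (rule openin_subset)
  show "topspace (seminorm_topology E p) \<subseteq> E"
    using openin_topspace[of "seminorm_topology E p"] by (simp only: openin_seminorm_topology)
qed

lemma continuous_map_seminorm_topology_inclusion:
  assumes EF: "E \<subseteq> F" and "K > 0"
    and le: "\<And>f. q f \<le> ennreal K * p f"
  shows "continuous_map (seminorm_topology E p) (seminorm_topology F q) (\<lambda>f. f)"
proof (subst continuous_map, intro conjI allI impI)
  show "(\<lambda>f. f) ` topspace (seminorm_topology E p) \<subseteq> topspace (seminorm_topology F q)"
    using EF by (simp add: topspace_seminorm_topology)
next
  fix U assume U: "openin (seminorm_topology F q) U"
  show "openin (seminorm_topology E p) {f \<in> topspace (seminorm_topology E p). f \<in> U}"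
    unfolding openin_seminorm_topology topspace_seminorm_topology
  proof (intro conjI ballI)
    fix f assume "f \<in> {f \<in> E. f \<in> U}"
    then have "\<exists>\<epsilon>>0. \<forall>g\<in>F. q (\<lambda>x. g x - f x) < \<epsilon> \<longrightarrow> g \<in> U"
      using U unfolding openin_seminorm_topology by simp
    then obtain \<epsilon> where \<epsilon>: "\<epsilon> > 0" "\<forall>g\<in>F. q (\<lambda>x. g x - f x) < \<epsilon> \<longrightarrow> g \<in> U"
      by auto
    have "g \<in> U" if "g \<in> E" and small: "p (\<lambda>x. g x - f x) < ennreal (1 / K) * \<epsilon>" for g
    proof (rule \<epsilon>(2)[rule_format])
      have "ennreal K * p (\<lambda>x. g x - f x) < ennreal K * (ennreal (1 / K) * \<epsilon>)"
        using small \<open>K > 0\<close> by (intro ennreal_mult_strict_left_mono) auto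
      also have "\<dots> = \<epsilon>"
        using \<open>K > 0\<close> by (simp add: mult.assoc[symmetric] flip: ennreal_mult)
      finally show "q (\<lambda>x. g x - f x) < \<epsilon>"
        using le[of "\<lambda>x. g x - f x"] by simp
      show "g \<in> F" using \<open>g \<in> E\<close> EF by auto
    qed
    moreover have "ennreal (1 / K) * \<epsilon> > 0"
      using \<epsilon>(1) \<open>K > 0\<close> by (simp add: ennreal_zero_less_mult_iff)
    ultimately show "\<exists>\<delta>>0. \<forall>g\<in>E. p (\<lambda>x. g x - f x) < \<delta> \<longrightarrow> g \<in> {f \<in> E. f \<in> U}"
      by (intro exI[of _ "ennreal (1 / K) * \<epsilon>"]) simp
  qed auto
qed

lemma locally_convex_topology_subtopology:
  assumes T: "locally_convex_topology F T" and E: "function_subspace E" and EF: "E \<subseteq> F"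
  shows "locally_convex_topology E (subtopology T E)"
proof -
  have top: "topspace T = F"
    and add: "continuous_map (prod_topology T T) T (\<lambda>(f, g). (\<lambda>x. f x + g x))"
    and scale: "continuous_map (prod_topology euclidean T) T (\<lambda>(c, f). (\<lambda>x. c * f x))"
    and base: "\<And>U. openin T U \<Longrightarrow> (\<lambda>_. 0) \<in> U \<Longrightarrow>
        \<exists>C V. openin T V \<and> (\<lambda>_. 0) \<in> V \<and> V \<subseteq> C \<and> C \<subseteq> U \<and>
           (\<forall>f\<in>C. \<forall>g\<in>C. \<forall>t::real. 0 \<le> t \<and> t \<le> 1 \<longrightarrow>
              (\<lambda>x. of_real (1 - t) * f x + of_real t * g x) \<in> C)"
    using T unfolding locally_convex_topology_def by blast+
  have prodE: "prod_topology (subtopology T E) (subtopology T E)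
      = subtopology (prod_topology T T) (E \<times> E)"
    by (rule subtopology_Times[symmetric])
  have "prod_topology euclidean (subtopology T E)
      = prod_topology (subtopology (euclidean :: complex topology) UNIV) (subtopology T E)"
    by simp
  also have "\<dots> = subtopology (prod_topology euclidean T) (UNIV \<times> E)"
    by (rule subtopology_Times[symmetric])
  finally have prodC: "prod_topology (euclidean :: complex topology) (subtopology T E)
      = subtopology (prod_topology euclidean T) (UNIV \<times> E)" .
  have "continuous_map (prod_topology (subtopology T E) (subtopology T E)) (subtopology T E)
      (\<lambda>(f, g). (\<lambda>x. f x + g x))"
    unfolding prodE using function_subspaceD(2)[OF E]
    by (intro continuous_map_into_subtopology continuous_map_from_subtopology add) auto
  moreover have "continuous_map (prod_topology euclidean (subtopology T E)) (subtopology T E)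
      (\<lambda>(c, f). (\<lambda>x. c * f x))"
    unfolding prodC using function_subspaceD(3)[OF E]
    by (intro continuous_map_into_subtopology continuous_map_from_subtopology scale) auto
  moreover have "\<exists>C V. openin (subtopology T E) V \<and> (\<lambda>_. 0) \<in> V \<and> V \<subseteq> C \<and> C \<subseteq> U \<and>
           (\<forall>f\<in>C. \<forall>g\<in>C. \<forall>t::real. 0 \<le> t \<and> t \<le> 1 \<longrightarrow>
              (\<lambda>x. of_real (1 - t) * f x + of_real t * g x) \<in> C)"
    if U: "openin (subtopology T E) U" "(\<lambda>_. 0) \<in> U" for U
  proof -
    obtain U' where U': "openin T U'" "U = U' \<inter> E"
      using U(1) by (auto simp: openin_subtopology)
    have "(\<lambda>_. 0) \<in> U'" using U' U(2) by simp
    then obtain C V where CV: "openin T V" "(\<lambda>_. 0) \<in> V" "V \<subseteq> C" "C \<subseteq> U'"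
      and conv: "\<forall>f\<in>C. \<forall>g\<in>C. \<forall>t::real. 0 \<le> t \<and> t \<le> 1 \<longrightarrow>
              (\<lambda>x. of_real (1 - t) * f x + of_real t * g x) \<in> C"
      using base[OF U'(1)] by (elim meta_impE exE conjE)
    show ?thesis
    proof (rule exI[of _ "C \<inter> E"], rule exI[of _ "V \<inter> E"], intro conjI ballI allI impI)
      show "openin (subtopology T E) (V \<inter> E)" using CV(1) by (auto simp: openin_subtopology)
      show "(\<lambda>_. 0) \<in> V \<inter> E" using CV(2) function_subspaceD(1)[OF E] by simp
    next
      fix f g and t :: real
      assume "f \<in> C \<inter> E" "g \<in> C \<inter> E" "0 \<le> t \<and> t \<le> 1"
      then have "f \<in> C" "g \<in> C" "f \<in> E" "g \<in> E" "0 \<le> t \<and> t \<le> 1" by auto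
      then show "(\<lambda>x. of_real (1 - t) * f x + of_real t * g x) \<in> C \<inter> E"
        by (intro IntI conv[rule_format] function_subspaceD(2)[OF E] function_subspaceD(3)[OF E])
    qed (use CV U' in simp_all, blast+)
  qed
  ultimately show ?thesis
    unfolding locally_convex_topology_def using top EF by (auto simp: Int_absorb1)
qed

lemma locally_convex_topology_indiscrete:
  assumes E: "function_subspace E"
  shows "locally_convex_topology E (topology_generated_by {E})"
proof -
  have op: "U = {} \<or> U = E" if "openin (topology_generated_by {E}) U" for U
  proof -
    have "generate_topology_on {E} U" using that by (rule openin_topology_generated_by)
    then show ?thesis
    proof induction
      case (UN K)
      then show ?case by blast
    qed auto
  qed
  have opE: "openin (topology_generated_by {E}) E" by (rule topology_generated_by_Basis) simp
  have top: "topspace (topology_generated_by {E}) = E" by simp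
  have cont: "continuous_map X (topology_generated_by {E}) h"
    if "h ` topspace X \<subseteq> E" for X :: "'b topology" and h
  proof (rule continuous_on_generated_topo)
    fix U assume "U \<in> {E}"
    then have "h -` U \<inter> topspace X = topspace X" using that by auto
    then show "openin X (h -` U \<inter> topspace X)" by simp
  qed (use that in simp)
  show ?thesis
    unfolding locally_convex_topology_def
  proof (intro conjI allI impI top)
    show "continuous_map (prod_topology (topology_generated_by {E}) (topology_generated_by {E}))
        (topology_generated_by {E}) (\<lambda>(f, g). (\<lambda>x. f x + g x))"
      by (intro cont) (use function_subspaceD(2)[OF E] in auto)
    show "continuous_map (prod_topology euclidean (topology_generated_by {E}))
        (topology_generated_by {E}) (\<lambda>(c, f). (\<lambda>x. c * f x))"
      by (intro cont) (use function_subspaceD(3)[OF E] in auto)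
  next
    fix U assume "openin (topology_generated_by {E}) U \<and> (\<lambda>_. 0) \<in> U"
    then have "U = E" using op[of U] by auto
    then show "\<exists>C V. openin (topology_generated_by {E}) V \<and> (\<lambda>_. 0) \<in> V \<and> V \<subseteq> C \<and> C \<subseteq> U \<and>
           (\<forall>f\<in>C. \<forall>g\<in>C. \<forall>t::real. 0 \<le> t \<and> t \<le> 1 \<longrightarrow>
              (\<lambda>x. of_real (1 - t) * f x + of_real t * g x) \<in> C)"
      by (intro exI[of _ E]) (simp add: opE function_subspaceD[OF E])
  qed
qed

text \<open>Every locally convex topology on the larger space that makes its steps continuous induces
  such a topology on the smaller space. Hence the generating open sets of the larger limit have open
  preimages. The indiscrete topology shows that the generating open sets cover the larger space.\<close>

lemma continuous_map_inductive_limit_inclusion: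
  assumes E: "function_subspace E" and F: "function_subspace F" and EF: "E \<subseteq> F"
    and \<S>: "\<And>S. S \<in> \<S> \<Longrightarrow> topspace S \<subseteq> E"
    and \<R>: "\<And>R. R \<in> \<R> \<Longrightarrow> topspace R \<subseteq> F"
    and step: "\<And>S. S \<in> \<S> \<Longrightarrow> \<exists>R\<in>\<R>. continuous_map S R (\<lambda>f. f)"
  shows "continuous_map (inductive_limit_topology E \<S>) (inductive_limit_topology F \<R>) (\<lambda>f. f)"
proof -
  define \<G> where "\<G> = (\<lambda>E \<S>. {U :: ('a \<Rightarrow> complex) set. \<exists>T. locally_convex_topology E T \<and>
               (\<forall>S\<in>\<S>. continuous_map S T (\<lambda>f. f)) \<and> openin T U})"
  have limit: "inductive_limit_topology E \<S> = topology_generated_by (\<G> E \<S>)"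
    for E and \<S> :: "('a \<Rightarrow> complex) topology set"
    unfolding inductive_limit_topology_def \<G>_def ..
  have topE: "topspace (inductive_limit_topology E \<S>) \<subseteq> E"
    unfolding limit topology_generated_by_topspace
    by (auto simp: \<G>_def locally_convex_topology_def dest: openin_subset)
  have "F \<in> \<G> F \<R>"
    unfolding \<G>_def
  proof (intro CollectI exI conjI ballI)
    show "locally_convex_topology F (topology_generated_by {F})"
      by (rule locally_convex_topology_indiscrete[OF F])
    show "openin (topology_generated_by {F}) F" by (rule topology_generated_by_Basis) simp
    fix R assume R: "R \<in> \<R>"
    show "continuous_map R (topology_generated_by {F}) (\<lambda>f. f)"
    proof (rule continuous_on_generated_topo)
      fix U assume "U \<in> {F}"
      then have "(\<lambda>f. f) -` U \<inter> topspace R = topspace R" using \<R>[OF R] by auto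
      then show "openin R ((\<lambda>f. f) -` U \<inter> topspace R)" by simp
    qed (use \<R>[OF R] in simp)
  qed
  then have cover: "E \<subseteq> \<Union> (\<G> F \<R>)" using EF by blast
  have restrict: "openin (inductive_limit_topology E \<S>) (U \<inter> E)" if U: "U \<in> \<G> F \<R>" for U
  proof -
    obtain T where T: "locally_convex_topology F T" "openin T U"
      and R: "\<And>R. R \<in> \<R> \<Longrightarrow> continuous_map R T (\<lambda>f. f)"
      using U unfolding \<G>_def by blast
    have "continuous_map S (subtopology T E) (\<lambda>f. f)" if S: "S \<in> \<S>" for S
    proof -
      obtain R where "R \<in> \<R>" "continuous_map S R (\<lambda>f. f)" using step[OF S] by blast
      then have "continuous_map S T (\<lambda>f. f)"
        using continuous_map_compose[of S R "\<lambda>f. f" T "\<lambda>f. f"] R by (simp add: o_def)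
      then show ?thesis using \<S>[OF S] by (intro continuous_map_into_subtopology) auto
    qed
    moreover have "openin (subtopology T E) (U \<inter> E)" using T(2) by (auto simp: openin_subtopology)
    ultimately have "U \<inter> E \<in> \<G> E \<S>"
      using locally_convex_topology_subtopology[OF T(1) E EF] by (auto simp: \<G>_def)
    then show ?thesis unfolding limit by (rule topology_generated_by_Basis)
  qed
  have op: "openin (inductive_limit_topology E \<S>)
      ((\<lambda>f. f) -` U \<inter> topspace (inductive_limit_topology E \<S>))" if "U \<in> \<G> F \<R>" for U
  proof -
    have "(\<lambda>f. f) -` U \<inter> topspace (inductive_limit_topology E \<S>)
        = (U \<inter> E) \<inter> topspace (inductive_limit_topology E \<S>)" using topE by auto
    then show ?thesis
      using restrict[OF that] by auto
  qed
  show ?thesis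
    unfolding limit[of F \<R>]
    by (rule continuous_on_generated_topo) (use op topE cover in auto)
qed

section \<open>Linearity of differentiation on smooth functions\<close>

definition smooth_on_space :: "nat \<Rightarrow> ((nat \<Rightarrow> real) \<Rightarrow> complex) \<Rightarrow> bool" where
  "smooth_on_space d f \<longleftrightarrow> (\<forall>k. C_k d k f)"

definition agree_on_space ::
  "nat \<Rightarrow> ((nat \<Rightarrow> real) \<Rightarrow> complex) \<Rightarrow> ((nat \<Rightarrow> real) \<Rightarrow> complex) \<Rightarrow> bool" where
  "agree_on_space d f g \<longleftrightarrow> (\<forall>x\<in>topspace (Euclidean_space d). f x = g x)"

lemma fun_upd_in_Euclidean_space:
  "x \<in> topspace (Euclidean_space d) \<Longrightarrow> i < d \<Longrightarrow> x(i := t) \<in> topspace (Euclidean_space d)"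
  by (auto simp: topspace_Euclidean_space)

lemma agree_on_space_slice:
  assumes "agree_on_space d f g" "i < d" "x \<in> topspace (Euclidean_space d)"
  shows "(\<lambda>t. f (x(i := t))) = (\<lambda>t. g (x(i := t)))"
  using assms fun_upd_in_Euclidean_space unfolding agree_on_space_def by blast

lemma agree_on_space_partial_deriv:
  assumes "agree_on_space d f g" "i < d"
  shows "agree_on_space d (partial_deriv i f) (partial_deriv i g)"
  using agree_on_space_slice[OF assms] by (simp add: agree_on_space_def partial_deriv_def)

lemma C_k_agree:
  "agree_on_space d f g \<Longrightarrow> C_k d k f \<Longrightarrow> C_k d k g"
proof (induction k arbitrary: f g)
  case 0
  then show ?case
    by (auto simp: agree_on_space_def intro: continuous_map_eq)
next
  case (Suc k)
  have "continuous_map (Euclidean_space d) euclidean g"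
    using Suc.prems by (auto simp: agree_on_space_def intro: continuous_map_eq)
  moreover have "C_k d k (partial_deriv i g)" if "i < d" for i
    using Suc.IH[OF agree_on_space_partial_deriv[OF Suc.prems(1) that]] Suc.prems(2) that by simp
  moreover have "(\<lambda>t. g (x(i := t))) differentiable at (x i)"
    if "i < d" "x \<in> topspace (Euclidean_space d)" for i x
    using Suc.prems(2) that unfolding agree_on_space_slice[OF Suc.prems(1) that, symmetric] by simp
  ultimately show ?case by simp
qed

lemma partial_deriv_lincomb:
  assumes "C_k d (Suc k) f" "C_k d (Suc k) g" "i < d"
  shows "agree_on_space d (partial_deriv i (\<lambda>x. a * f x + b * g x))
           (\<lambda>x. a * partial_deriv i f x + b * partial_deriv i g x)"
  unfolding agree_on_space_def
proof
  fix x assume x: "x \<in> topspace (Euclidean_space d)"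
  have f: "((\<lambda>t. f (x(i := t))) has_vector_derivative partial_deriv i f x) (at (x i))"
    and g: "((\<lambda>t. g (x(i := t))) has_vector_derivative partial_deriv i g x) (at (x i))"
    using assms x by (auto simp: partial_deriv_def vector_derivative_works[symmetric])
  have "((\<lambda>t. a * f (x(i := t)) + b * g (x(i := t))) has_vector_derivative
      a * partial_deriv i f x + b * partial_deriv i g x) (at (x i))"
    by (intro has_vector_derivative_add has_vector_derivative_mult_right f g)
  then show "partial_deriv i (\<lambda>x. a * f x + b * g x) x
      = a * partial_deriv i f x + b * partial_deriv i g x"
    unfolding partial_deriv_def by (rule vector_derivative_at)
qed

lemma continuous_map_Euclidean_space_iff:
  fixes f :: "(nat \<Rightarrow> real) \<Rightarrow> complex"
  shows "continuous_map (Euclidean_space d) euclidean f \<longleftrightarrow>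
    continuous_on (topspace (Euclidean_space d)) f"
  by (simp add: Euclidean_space_def euclidean_product_topology)

lemma C_k_lincomb:
  "C_k d k f \<Longrightarrow> C_k d k g \<Longrightarrow> C_k d k (\<lambda>x. a * f x + b * g x)"
proof (induction k arbitrary: f g)
  case 0
  then show ?case
    by (auto simp: continuous_map_Euclidean_space_iff intro!: continuous_intros)
next
  case (Suc k)
  have "continuous_map (Euclidean_space d) euclidean (\<lambda>x. a * f x + b * g x)"
    using Suc.prems by (auto simp: continuous_map_Euclidean_space_iff intro!: continuous_intros)
  moreover have "(\<lambda>t. a * f (x(i := t)) + b * g (x(i := t))) differentiable at (x i)"
    if "i < d" "x \<in> topspace (Euclidean_space d)" for i x
    using Suc.prems that by (intro differentiable_add differentiable_mult) auto
  moreover have "C_k d k (partial_deriv i (\<lambda>x. a * f x + b * g x))" if i: "i < d" for i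
  proof (rule C_k_agree)
    show "agree_on_space d (\<lambda>x. a * partial_deriv i f x + b * partial_deriv i g x)
        (partial_deriv i (\<lambda>x. a * f x + b * g x))"
      using partial_deriv_lincomb[OF Suc.prems i] by (simp add: agree_on_space_def)
    show "C_k d k (\<lambda>x. a * partial_deriv i f x + b * partial_deriv i g x)"
      using Suc.prems i by (intro Suc.IH) auto
  qed
  ultimately show ?case by simp
qed

text \<open>Only the restriction of a function to \<open>\<real>\<^sup>d\<close> matters, so linearity of a differential
  operator can be asserted only up to agreement there. Compatibility with agreement is therefore
  part of the notion: without it the property would not pass to compositions.\<close>

definition linear_smooth_operator ::
  "nat \<Rightarrow> (((nat \<Rightarrow> real) \<Rightarrow> complex) \<Rightarrow> (nat \<Rightarrow> real) \<Rightarrow> complex) \<Rightarrow> bool" where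
  "linear_smooth_operator d P \<longleftrightarrow>
     (\<forall>f. smooth_on_space d f \<longrightarrow> smooth_on_space d (P f)) \<and>
     (\<forall>f g. agree_on_space d f g \<longrightarrow> agree_on_space d (P f) (P g)) \<and>
     (\<forall>a b f g. smooth_on_space d f \<longrightarrow> smooth_on_space d g \<longrightarrow>
        agree_on_space d (P (\<lambda>x. a * f x + b * g x)) (\<lambda>x. a * P f x + b * P g x))"

lemma linear_smooth_operator_id: "linear_smooth_operator d (\<lambda>f. f)"
  by (simp add: linear_smooth_operator_def agree_on_space_def)

lemma linear_smooth_operator_compose:
  assumes P: "linear_smooth_operator d P" and Q: "linear_smooth_operator d Q"
  shows "linear_smooth_operator d (P \<circ> Q)"
  unfolding linear_smooth_operator_def o_def
proof (intro conjI allI impI)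
  fix a b f g assume fg: "smooth_on_space d f" "smooth_on_space d g"
  then have "agree_on_space d (Q (\<lambda>x. a * f x + b * g x)) (\<lambda>x. a * Q f x + b * Q g x)"
    using Q by (simp add: linear_smooth_operator_def)
  then have "agree_on_space d (P (Q (\<lambda>x. a * f x + b * g x))) (P (\<lambda>x. a * Q f x + b * Q g x))"
    using P by (simp add: linear_smooth_operator_def)
  moreover have "agree_on_space d (P (\<lambda>x. a * Q f x + b * Q g x))
      (\<lambda>x. a * P (Q f) x + b * P (Q g) x)"
    using P Q fg by (simp add: linear_smooth_operator_def)
  ultimately show "agree_on_space d (P (Q (\<lambda>x. a * f x + b * g x)))
      (\<lambda>x. a * P (Q f) x + b * P (Q g) x)"
    by (simp add: agree_on_space_def)
qed (use P Q in \<open>auto simp: linear_smooth_operator_def\<close>)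

lemma linear_smooth_operator_partial_deriv:
  assumes "i < d"
  shows "linear_smooth_operator d (partial_deriv i)"
  unfolding linear_smooth_operator_def
proof (intro conjI allI impI)
  fix f assume "smooth_on_space d f"
  then have "C_k d (Suc k) f" for k by (simp add: smooth_on_space_def del: C_k.simps)
  then show "smooth_on_space d (partial_deriv i f)"
    using assms by (auto simp: smooth_on_space_def)
next
  fix a b f g assume "smooth_on_space d f" "smooth_on_space d g"
  then have "C_k d (Suc 0) f" "C_k d (Suc 0) g"
    by (simp_all add: smooth_on_space_def del: C_k.simps)
  then show "agree_on_space d (partial_deriv i (\<lambda>x. a * f x + b * g x))
           (\<lambda>x. a * partial_deriv i f x + b * partial_deriv i g x)"
    using assms by (rule partial_deriv_lincomb)
qed (use assms agree_on_space_partial_deriv in blast)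

lemma linear_smooth_operator_multi_deriv: "linear_smooth_operator d (multi_deriv d \<beta>)"
proof -
  have pow: "linear_smooth_operator d (partial_deriv i ^^ n)" if "i < d" for i n
    using linear_smooth_operator_partial_deriv[OF that]
    by (induction n) (simp_all add: linear_smooth_operator_id id_def linear_smooth_operator_compose)
  have "linear_smooth_operator d (foldr (\<lambda>i. partial_deriv i ^^ \<beta> i) is)"
    if "set is \<subseteq> {..<d}" for "is"
    using that
    by (induction "is")
      (auto simp: linear_smooth_operator_id id_def intro!: linear_smooth_operator_compose pow)
  from this[of "[0..<d]"] show ?thesis
    unfolding multi_deriv_def by (simp add: atLeast0LessThan)
qed

section \<open>Domination of norms and inclusion of spaces\<close>

lemma growth_weight_pos: "growth_weight G \<omega> d \<mu> \<alpha> \<beta> > 0"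
  by (cases G) (auto simp: weight_matrix_pos)

text \<open>Estimates of the norms become pointwise estimates, without suprema and quotients of extended
  reals.\<close>

lemma GS_norm_le_iff:
  "GS_norm G \<omega> d \<mu> f \<le> B \<longleftrightarrow>
     (\<forall>\<alpha>\<in>multi_indices d. \<forall>\<beta>\<in>multi_indices d. \<forall>x\<in>topspace (Euclidean_space d).
        ennreal (cmod (of_real (monomial d \<alpha> x) * multi_deriv d \<beta> f x))
          \<le> ennreal (growth_weight G \<omega> d \<mu> \<alpha> \<beta>) * B)"
proof -
  have "a / ennreal w \<le> B \<longleftrightarrow> a \<le> ennreal w * B" if "w > 0" for a w
  proof
    assume "a / ennreal w \<le> B"
    then have "ennreal w * (a / ennreal w) \<le> ennreal w * B" by (rule mult_left_mono) simp
    then show "a \<le> ennreal w * B"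
      using that by (simp add: ennreal_times_divide ennreal_mult_divide_eq mult.commute)
  qed (use that in \<open>auto intro: divide_le_posI_ennreal\<close>)
  then show ?thesis
    unfolding GS_norm_def sup_norm_def SUP_le_iff
    by (simp add: growth_weight_pos SUP_le_iff)
qed

lemma cmod_le_GS_norm:
  assumes "\<alpha> \<in> multi_indices d" "\<beta> \<in> multi_indices d" "x \<in> topspace (Euclidean_space d)"
  shows "ennreal (cmod (of_real (monomial d \<alpha> x) * multi_deriv d \<beta> f x))
          \<le> ennreal (growth_weight G \<omega> d \<mu> \<alpha> \<beta>) * GS_norm G \<omega> d \<mu> f"
  using GS_norm_le_iff[of G \<omega> d \<mu> f "GS_norm G \<omega> d \<mu> f"] assms by blast

lemma GS_norm_lincomb:
  assumes f: "f \<in> C_infinity d" and g: "g \<in> C_infinity d"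
  shows "GS_norm G \<omega> d \<mu> (\<lambda>x. a * f x + b * g x)
           \<le> ennreal (cmod a) * GS_norm G \<omega> d \<mu> f + ennreal (cmod b) * GS_norm G \<omega> d \<mu> g"
  unfolding GS_norm_le_iff
proof (intro ballI)
  fix \<alpha> \<beta> x assume *: "\<alpha> \<in> multi_indices d" "\<beta> \<in> multi_indices d" "x \<in> topspace (Euclidean_space d)"
  let ?m = "complex_of_real (monomial d \<alpha> x)" and ?w = "ennreal (growth_weight G \<omega> d \<mu> \<alpha> \<beta>)"
  have "multi_deriv d \<beta> (\<lambda>x. a * f x + b * g x) x = a * multi_deriv d \<beta> f x + b * multi_deriv d \<beta> g x"
    using linear_smooth_operator_multi_deriv[of d \<beta>] f g *(3)
    by (simp add: linear_smooth_operator_def agree_on_space_def smooth_on_space_def C_infinity_def)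
  then have "cmod (?m * multi_deriv d \<beta> (\<lambda>x. a * f x + b * g x) x)
      = cmod (a * (?m * multi_deriv d \<beta> f x) + b * (?m * multi_deriv d \<beta> g x))"
    by (simp add: algebra_simps)
  also have "\<dots> \<le> cmod (a * (?m * multi_deriv d \<beta> f x)) + cmod (b * (?m * multi_deriv d \<beta> g x))"
    by (rule norm_triangle_ineq)
  finally have "ennreal (cmod (?m * multi_deriv d \<beta> (\<lambda>x. a * f x + b * g x) x))
      \<le> ennreal (cmod (a * (?m * multi_deriv d \<beta> f x)) + cmod (b * (?m * multi_deriv d \<beta> g x)))"
    by (rule ennreal_leI)
  also have "\<dots> = ennreal (cmod a) * ennreal (cmod (?m * multi_deriv d \<beta> f x))
      + ennreal (cmod b) * ennreal (cmod (?m * multi_deriv d \<beta> g x))"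
    by (simp only: norm_mult[of a] norm_mult[of b] ennreal_plus ennreal_mult norm_ge_zero
        mult_nonneg_nonneg)
  also have "\<dots> \<le> ennreal (cmod a) * (?w * GS_norm G \<omega> d \<mu> f)
      + ennreal (cmod b) * (?w * GS_norm G \<omega> d \<mu> g)"
    by (intro add_mono mult_left_mono cmod_le_GS_norm *) auto
  also have "\<dots> = ?w * (ennreal (cmod a) * GS_norm G \<omega> d \<mu> f + ennreal (cmod b) * GS_norm G \<omega> d \<mu> g)"
    by (simp only: distrib_left mult_ac)
  finally show "ennreal (cmod (?m * multi_deriv d \<beta> (\<lambda>x. a * f x + b * g x) x)) \<le> \<dots>" .
qed

lemma multi_length_add: "multi_length d (\<lambda>i. \<alpha> i + \<beta> i) = multi_length d \<alpha> + multi_length d \<beta>"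
  by (simp add: multi_length_def sum.distrib)

text \<open>Super- and submultiplicativity of the weight matrix make joint and separated growth
  interchangeable at the price of doubling the parameter, so the four combinations of growth
  conditions reduce to one.\<close>

lemma growth_weight_dominated:
  assumes \<omega>: "general_weight_function \<omega>" and \<sigma>: "general_weight_function \<sigma>"
    and C: "C > 0" and le: "\<And>t. t \<ge> 1 \<Longrightarrow> \<sigma> t \<le> C * \<omega> t + C" and \<mu>: "\<mu> > 0"
  shows "growth_weight G \<omega> d \<mu> \<alpha> \<beta> \<le> exp (1 / \<mu>) * growth_weight H \<sigma> d (2 * (C * \<mu>)) \<alpha> \<beta>"
proof -
  let ?a = "multi_length d \<alpha>" and ?b = "multi_length d \<beta>" and ?\<nu> = "C * \<mu>"
  have \<nu>: "?\<nu> > 0" "2 * ?\<nu> > 0" using C \<mu> by auto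
  have "growth_weight G \<omega> d \<mu> \<alpha> \<beta> \<le> weight_matrix \<omega> \<mu> (?a + ?b)"
    using weight_matrix_supermult[OF \<omega> \<mu>, of ?a ?b] by (cases G) (simp_all add: multi_length_add)
  also have "\<dots> \<le> exp (1 / \<mu>) * weight_matrix \<sigma> ?\<nu> (?a + ?b)"
    by (rule weight_matrix_dominated[OF \<sigma> \<mu> C le])
  also have "weight_matrix \<sigma> ?\<nu> (?a + ?b) \<le> growth_weight H \<sigma> d (2 * ?\<nu>) \<alpha> \<beta>"
    using weight_matrix_submult[OF \<sigma> \<nu>(1), of ?a ?b] weight_matrix_supermult[OF \<sigma> \<nu>(2), of ?a ?b]
    by (cases H) (simp_all add: multi_length_add)
  finally show ?thesis by simp
qed

lemma GS_norm_dominated: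
  assumes \<omega>: "general_weight_function \<omega>" and \<sigma>: "general_weight_function \<sigma>"
    and C: "C > 0" and le: "\<And>t. t \<ge> 1 \<Longrightarrow> \<sigma> t \<le> C * \<omega> t + C" and \<mu>: "\<mu> > 0"
  shows "GS_norm H \<sigma> d (2 * (C * \<mu>)) f \<le> ennreal (exp (1 / \<mu>)) * GS_norm G \<omega> d \<mu> f"
  unfolding GS_norm_le_iff
proof (intro ballI)
  fix \<alpha> \<beta> x assume *: "\<alpha> \<in> multi_indices d" "\<beta> \<in> multi_indices d" "x \<in> topspace (Euclidean_space d)"
  have "ennreal (cmod (of_real (monomial d \<alpha> x) * multi_deriv d \<beta> f x))
      \<le> ennreal (growth_weight G \<omega> d \<mu> \<alpha> \<beta>) * GS_norm G \<omega> d \<mu> f"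
    by (rule cmod_le_GS_norm[OF *])
  also have "\<dots> \<le> ennreal (exp (1 / \<mu>) * growth_weight H \<sigma> d (2 * (C * \<mu>)) \<alpha> \<beta>) * GS_norm G \<omega> d \<mu> f"
    by (intro mult_right_mono ennreal_leI growth_weight_dominated \<omega> \<sigma> C le \<mu>) auto
  also have "\<dots> = ennreal (growth_weight H \<sigma> d (2 * (C * \<mu>)) \<alpha> \<beta>) * (ennreal (exp (1 / \<mu>)) * GS_norm G \<omega> d \<mu> f)"
    using growth_weight_pos[of H \<sigma> d "2 * (C * \<mu>)" \<alpha> \<beta>]
    by (simp add: ennreal_mult less_imp_le mult_ac)
  finally show "ennreal (cmod (of_real (monomial d \<alpha> x) * multi_deriv d \<beta> f x)) \<le> \<dots>" .
qed

lemma GS_step_dominated: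
  assumes "general_weight_function \<omega>" "general_weight_function \<sigma>"
    and "C > 0" "\<And>t. t \<ge> 1 \<Longrightarrow> \<sigma> t \<le> C * \<omega> t + C" "\<mu> > 0"
  shows "GS_step G \<omega> d \<mu> \<subseteq> GS_step H \<sigma> d (2 * (C * \<mu>))"
proof
  fix f assume f: "f \<in> GS_step G \<omega> d \<mu>"
  have "GS_norm H \<sigma> d (2 * (C * \<mu>)) f \<le> ennreal (exp (1 / \<mu>)) * GS_norm G \<omega> d \<mu> f"
    by (rule GS_norm_dominated[OF assms])
  also have "\<dots> < \<infinity>" using f by (simp add: GS_step_def ennreal_mult_less_top)
  finally show "f \<in> GS_step H \<sigma> d (2 * (C * \<mu>))" using f by (simp add: GS_step_def)
qed

lemma GS_space_mono:
  assumes "general_weight_function \<omega>" "general_weight_function \<sigma>" "\<omega> \<preceq>\<^sub>w \<sigma>"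
  shows "GS_space G \<omega> d \<subseteq> GS_space H \<sigma> d"
proof -
  obtain C where C: "C > 0" "\<And>t. t \<ge> 1 \<Longrightarrow> \<sigma> t \<le> C * \<omega> t + C"
    using weight_preceq_iff[OF assms(1,2)] assms(3) by blast
  show ?thesis
  proof
    fix f assume "f \<in> GS_space G \<omega> d"
    then obtain \<mu> where "\<mu> > 0" "f \<in> GS_step G \<omega> d \<mu>" by (auto simp: GS_space_def)
    then have "2 * (C * \<mu>) > 0" "f \<in> GS_step H \<sigma> d (2 * (C * \<mu>))"
      using GS_step_dominated[OF assms(1,2) C, of \<mu> G d H] C(1) by auto
    then show "f \<in> GS_space H \<sigma> d" unfolding GS_space_def by blast
  qed
qed

text \<open>Two elements of the union have to be brought into a common step first. Domination
  of the weight by itself with a constant \<open>C \<ge> 1\<close> gives \<open>GS_step G \<omega> d \<mu> \<subseteq> GS_step G \<omega> d (2 C \<mu>)\<close>,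
  and \<open>C\<close> can be tuned so that both parameters become the same number.\<close>

lemma function_subspace_GS_space:
  assumes \<omega>: "general_weight_function \<omega>"
  shows "function_subspace (GS_space G \<omega> d)"
proof -
  have grow: "GS_step G \<omega> d \<mu> \<subseteq> GS_step G \<omega> d \<nu>" if "\<mu> > 0" "2 * \<mu> \<le> \<nu>" for \<mu> \<nu>
  proof -
    have C: "\<nu> / (2 * \<mu>) \<ge> 1" using that by simp
    have "\<omega> t \<le> \<nu> / (2 * \<mu>) * \<omega> t + \<nu> / (2 * \<mu>)" if "t \<ge> 1" for t
      using mult_right_mono[OF C, of "\<omega> t"] general_weight_functionD(2)[OF \<omega>, of t] that C by linarith
    then have "GS_step G \<omega> d \<mu> \<subseteq> GS_step G \<omega> d (2 * (\<nu> / (2 * \<mu>) * \<mu>))"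
      using that C by (intro GS_step_dominated[OF \<omega> \<omega>]) auto
    then show ?thesis using that by simp
  qed
  have lin: "(\<lambda>x. a * f x + b * g x) \<in> GS_space G \<omega> d"
    if fg: "f \<in> GS_space G \<omega> d" "g \<in> GS_space G \<omega> d" for a b f g
  proof -
    obtain \<mu> \<nu> where "\<mu> > 0" "\<nu> > 0" "f \<in> GS_step G \<omega> d \<mu>" "g \<in> GS_step G \<omega> d \<nu>"
      using fg by (auto simp: GS_space_def)
    then obtain \<kappa> where \<kappa>: "\<kappa> > 0" "f \<in> GS_step G \<omega> d \<kappa>" "g \<in> GS_step G \<omega> d \<kappa>"
      using grow[of \<mu> "2 * (\<mu> + \<nu>)"] grow[of \<nu> "2 * (\<mu> + \<nu>)"] that[of "2 * (\<mu> + \<nu>)"] by auto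
    then have C: "f \<in> C_infinity d" "g \<in> C_infinity d" by (auto simp: GS_step_def)
    then have "(\<lambda>x. a * f x + b * g x) \<in> C_infinity d"
      by (simp add: C_infinity_def C_k_lincomb)
    moreover have "GS_norm G \<omega> d \<kappa> (\<lambda>x. a * f x + b * g x) < \<infinity>"
      using GS_norm_lincomb[OF C, of G \<omega> \<kappa> a b] \<kappa>
      by (auto simp: GS_step_def ennreal_mult_less_top intro: order.strict_trans1)
    ultimately show ?thesis using \<kappa>(1) by (auto simp: GS_space_def GS_step_def)
  qed
  have "C_k d k (\<lambda>_. 0)" for k
  proof (induction k)
    case (Suc k)
    have "partial_deriv i (\<lambda>_. 0) = (\<lambda>_. 0)" for i by (simp add: partial_deriv_def)
    then show ?case using Suc by simp
  qed simp
  then have zero: "(\<lambda>_. 0) \<in> C_infinity d" by (simp add: C_infinity_def)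
  have "GS_norm G \<omega> d 1 (\<lambda>_. 0) \<le> 0"
    using GS_norm_lincomb[OF zero zero, of G \<omega> 1 0 0] by simp
  then have "(\<lambda>_. 0) \<in> GS_space G \<omega> d" using zero by (auto simp: GS_space_def GS_step_def intro!: bexI[of _ 1])
  then show ?thesis
    unfolding function_subspace_def
    using lin[of _ _ 1 1] lin[of _ "\<lambda>_. 0" _ 0] by auto
qed

lemma continuous_map_GS_topology:
  assumes "general_weight_function \<omega>" "general_weight_function \<sigma>" "\<omega> \<preceq>\<^sub>w \<sigma>"
  shows "continuous_map (GS_topology G \<omega> d) (GS_topology H \<sigma> d) (\<lambda>f. f)"
proof -
  obtain C where C: "C > 0" "\<And>t. t \<ge> 1 \<Longrightarrow> \<sigma> t \<le> C * \<omega> t + C"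
    using weight_preceq_iff[OF assms(1,2)] assms(3) by blast
  show ?thesis
    unfolding GS_topology_def
  proof (rule continuous_map_inductive_limit_inclusion)
    fix S assume "S \<in> {seminorm_topology (GS_step G \<omega> d \<mu>) (GS_norm G \<omega> d \<mu>) | \<mu>. \<mu> > 0}"
    then obtain \<mu> where \<mu>: "\<mu> > 0" "S = seminorm_topology (GS_step G \<omega> d \<mu>) (GS_norm G \<omega> d \<mu>)"
      by blast
    let ?\<nu> = "2 * (C * \<mu>)"
    have "continuous_map S (seminorm_topology (GS_step H \<sigma> d ?\<nu>) (GS_norm H \<sigma> d ?\<nu>)) (\<lambda>f. f)"
      unfolding \<mu>(2)
      by (rule continuous_map_seminorm_topology_inclusion[where K = "exp (1 / \<mu>)"])
        (use GS_step_dominated[OF assms(1,2) C \<mu>(1)] GS_norm_dominated[OF assms(1,2) C \<mu>(1)] in auto)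
    moreover have "?\<nu> > 0" using C \<mu> by simp
    ultimately show "\<exists>R\<in>{seminorm_topology (GS_step H \<sigma> d \<mu>) (GS_norm H \<sigma> d \<mu>) | \<mu>. \<mu> > 0}.
        continuous_map S R (\<lambda>f. f)" by blast
  qed (use assms function_subspace_GS_space GS_space_mono
       in \<open>auto simp: topspace_seminorm_topology GS_space_def\<close>)
qed

section \<open>Modulated Gaussians\<close>

text \<open>The derivatives of \<open>G(x) = exp(i \<nu> x - x\<^sup>2 / 2)\<close>, generated by the recursion that results
  from differentiating \<open>G' = (i \<nu> - x) G\<close> repeatedly.\<close>

fun modulated_gaussian_deriv :: "real \<Rightarrow> nat \<Rightarrow> real \<Rightarrow> complex" where
  "modulated_gaussian_deriv \<nu> 0 x = exp (\<i> * of_real (\<nu> * x) - of_real (x\<^sup>2 / 2))"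
| "modulated_gaussian_deriv \<nu> (Suc 0) x =
     (\<i> * of_real \<nu> - of_real x) * modulated_gaussian_deriv \<nu> 0 x"
| "modulated_gaussian_deriv \<nu> (Suc (Suc k)) x =
     (\<i> * of_real \<nu> - of_real x) * modulated_gaussian_deriv \<nu> (Suc k) x
       - of_nat (Suc k) * modulated_gaussian_deriv \<nu> k x"

lemma has_vector_derivative_modulated_gaussian_deriv:
  "(modulated_gaussian_deriv \<nu> k has_vector_derivative modulated_gaussian_deriv \<nu> (Suc k) x) (at x)"
proof (induction k rule: less_induct)
  case (less k)
  have lin: "((\<lambda>x. \<i> * of_real \<nu> - complex_of_real x) has_vector_derivative - 1) (at x)"
    by (auto intro!: derivative_eq_intros has_vector_derivative_of_real)
  consider (1) "k = 0" | (2) "k = Suc 0" | (3) j where "k = Suc (Suc j)"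
    by (metis not0_implies_Suc)
  then show ?case
  proof cases
    case 1
    have "((\<lambda>z. exp (\<i> * of_real \<nu> * z - z\<^sup>2 / 2)) has_field_derivative
        (\<i> * of_real \<nu> - of_real x) * exp (\<i> * of_real \<nu> * of_real x - (of_real x)\<^sup>2 / 2))
        (at (complex_of_real x))"
      by (auto intro!: derivative_eq_intros simp: field_simps)
    from has_vector_derivative_real_field[OF this] show ?thesis
      by (simp add: 1 mult.assoc fun_eq_iff)
  next
    case 2
    have "((\<lambda>x. (\<i> * of_real \<nu> - of_real x) * modulated_gaussian_deriv \<nu> 0 x) has_vector_derivative
        (\<i> * of_real \<nu> - of_real x) * modulated_gaussian_deriv \<nu> (Suc 0) x
        + (- 1) * modulated_gaussian_deriv \<nu> 0 x) (at x)"
      by (intro has_vector_derivative_mult lin less.IH) (simp add: 2)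
    moreover have "modulated_gaussian_deriv \<nu> (Suc 0)
        = (\<lambda>x. (\<i> * of_real \<nu> - of_real x) * modulated_gaussian_deriv \<nu> 0 x)"
      by (simp add: fun_eq_iff)
    ultimately show ?thesis using 2 by (simp del: modulated_gaussian_deriv.simps(1))
  next
    case 3
    have "((\<lambda>x. (\<i> * of_real \<nu> - of_real x) * modulated_gaussian_deriv \<nu> (Suc j) x
          - of_nat (Suc j) * modulated_gaussian_deriv \<nu> j x) has_vector_derivative
        ((\<i> * of_real \<nu> - of_real x) * modulated_gaussian_deriv \<nu> (Suc (Suc j)) x
          + (- 1) * modulated_gaussian_deriv \<nu> (Suc j) x)
          - of_nat (Suc j) * modulated_gaussian_deriv \<nu> (Suc j) x) (at x)"
      by (intro has_vector_derivative_diff has_vector_derivative_mult_right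
          has_vector_derivative_mult lin less.IH) (simp_all add: 3)
    moreover have "modulated_gaussian_deriv \<nu> (Suc (Suc j))
        = (\<lambda>x. (\<i> * of_real \<nu> - of_real x) * modulated_gaussian_deriv \<nu> (Suc j) x
          - of_nat (Suc j) * modulated_gaussian_deriv \<nu> j x)"
      by (simp add: fun_eq_iff)
    ultimately show ?thesis
      unfolding 3 modulated_gaussian_deriv.simps(3)[of \<nu> "Suc j"]
      by (simp add: algebra_simps del: modulated_gaussian_deriv.simps)
  qed
qed

text \<open>The recursion has the characteristic inequality \<open>y (y + s) + k \<le> (y + s)\<^sup>2\<close>, which
  closes the induction as long as \<open>k \<le> s\<^sup>2\<close>.\<close>

lemma cmod_modulated_gaussian_deriv_le:
  assumes "\<nu> \<ge> 0" "s \<ge> 0"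
  shows "real k \<le> s\<^sup>2 \<Longrightarrow>
    cmod (modulated_gaussian_deriv \<nu> k x) \<le> (\<nu> + \<bar>x\<bar> + s) ^ k * exp (- x\<^sup>2 / 2)"
proof (induction \<nu>\<equiv>\<nu> k x rule: modulated_gaussian_deriv.induct)
  case (1 x)
  show ?case by simp
next
  case (2 x)
  have "cmod (\<i> * of_real \<nu> - of_real x) \<le> \<nu> + \<bar>x\<bar> + s"
    using norm_triangle_ineq4[of "\<i> * of_real \<nu>" "of_real x"] assms by (simp add: norm_mult)
  then show ?case by (simp add: norm_mult mult_right_mono)
next
  case (3 k x)
  let ?y = "\<nu> + \<bar>x\<bar>" and ?e = "exp (- x\<^sup>2 / 2)"
  have k: "real k \<le> s\<^sup>2" "real (Suc k) \<le> s\<^sup>2" using 3(3) by simp_all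
  have y: "?y \<ge> 0" using assms by simp
  have lin: "cmod (\<i> * of_real \<nu> - of_real x) \<le> ?y"
    using norm_triangle_ineq4[of "\<i> * of_real \<nu>" "of_real x"] assms by (simp add: norm_mult)
  have "cmod (modulated_gaussian_deriv \<nu> (Suc (Suc k)) x)
      \<le> cmod ((\<i> * of_real \<nu> - of_real x) * modulated_gaussian_deriv \<nu> (Suc k) x)
        + cmod (of_nat (Suc k) * modulated_gaussian_deriv \<nu> k x)"
    unfolding modulated_gaussian_deriv.simps(3) by (rule norm_triangle_ineq4)
  also have "\<dots> \<le> ?y * ((?y + s) ^ Suc k * ?e) + s\<^sup>2 * ((?y + s) ^ k * ?e)"
    unfolding norm_mult norm_of_nat
    by (intro add_mono mult_mono lin 3(1,2) k) (use y in auto)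
  also have "\<dots> = (?y * (?y + s) + s\<^sup>2) * ((?y + s) ^ k * ?e)"
    by (simp add: algebra_simps)
  also have "\<dots> \<le> (?y + s)\<^sup>2 * ((?y + s) ^ k * ?e)"
  proof (rule mult_right_mono)
    have "0 \<le> ?y * s" using y assms by (intro mult_nonneg_nonneg) auto
    then show "?y * (?y + s) + s\<^sup>2 \<le> (?y + s)\<^sup>2"
      by (simp add: power2_eq_square algebra_simps)
  qed (use y assms in simp)
  also have "\<dots> = (?y + s) ^ Suc (Suc k) * ?e"
    by (simp add: power2_eq_square)
  finally show ?case .
qed

text \<open>On the imaginary axis \<open>G(-i w) = exp(\<nu> w + w\<^sup>2 / 2)\<close> has nonnegative Taylor coefficients.
  Thus the derivatives at the origin have the common phases \<open>i\<^sup>k\<close>, independent of \<open>\<nu>\<close>, and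
  superpositions with positive coefficients cannot cancel there.\<close>

lemma modulated_gaussian_deriv_0_ge:
  assumes "\<nu> \<ge> 0"
  shows "\<exists>r\<ge>\<nu> ^ k. modulated_gaussian_deriv \<nu> k 0 = \<i> ^ k * of_real r"
proof (induction k rule: less_induct)
  case (less k)
  consider (1) "k = 0" | (2) "k = Suc 0" | (3) j where "k = Suc (Suc j)"
    by (metis not0_implies_Suc)
  then show ?case
  proof cases
    case 1
    then show ?thesis by (intro exI[of _ 1]) simp
  next
    case 2
    then show ?thesis by (intro exI[of _ \<nu>]) simp
  next
    case 3
    obtain r where r: "r \<ge> \<nu> ^ Suc j" "modulated_gaussian_deriv \<nu> (Suc j) 0 = \<i> ^ Suc j * of_real r"
      using less[of "Suc j"] 3 by blast
    obtain q where q: "q \<ge> \<nu> ^ j" "modulated_gaussian_deriv \<nu> j 0 = \<i> ^ j * of_real q"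
      using less[of j] 3 by auto
    have "modulated_gaussian_deriv \<nu> k 0 = \<i> ^ k * of_real (\<nu> * r + Suc j * q)"
      unfolding 3 modulated_gaussian_deriv.simps(3) r(2) q(2)
      by (simp add: algebra_simps)
    moreover have "\<nu> ^ k \<le> \<nu> * r + Suc j * q"
    proof -
      have "\<nu> * \<nu> ^ Suc j \<le> \<nu> * r" using r(1) assms by (intro mult_left_mono)
      moreover have "0 \<le> q" using q(1) assms zero_le_power[of \<nu> j] by linarith
      then have "0 \<le> Suc j * q" by simp
      ultimately show ?thesis unfolding 3 power_Suc[of \<nu> "Suc j"] by linarith
    qed
    ultimately show ?thesis by blast
  qed
qed

section \<open>Bounding modulated Gaussians by the weight matrix\<close>

lemma power_sum3_le:
  fixes a b c :: real
  assumes "a \<ge> 0" "b \<ge> 0" "c \<ge> 0"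
  shows "(a + b + c) ^ k \<le> 3 ^ k * (a ^ k + b ^ k + c ^ k)"
proof -
  define m where "m = max a (max b c)"
  have "(a + b + c) ^ k \<le> (3 * m) ^ k"
    using assms by (intro power_mono) (auto simp: m_def)
  also have "\<dots> = 3 ^ k * m ^ k" by (rule power_mult_distrib)
  also have "m ^ k \<le> a ^ k + b ^ k + c ^ k"
    unfolding m_def using assms by (auto simp: max_def add_increasing add_increasing2)
  finally show ?thesis by simp
qed

lemma weight_function_le_square:
  assumes "weight_function \<omega>"
  shows "\<exists>A>0. \<forall>t\<ge>1. \<omega> t \<le> A * t\<^sup>2"
proof -
  have \<omega>: "general_weight_function \<omega>" and "\<omega> \<in> O[at_top](\<lambda>t. t\<^sup>2)"
    using assms by (auto simp: weight_function_def)
  then obtain c where c: "c > 0" and "eventually (\<lambda>t. norm (\<omega> t) \<le> c * norm (t\<^sup>2)) at_top"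
    by (auto elim: landau_o.bigE)
  then obtain N where N: "\<And>t. t \<ge> N \<Longrightarrow> norm (\<omega> t) \<le> c * norm (t\<^sup>2)"
    unfolding eventually_at_top_linorder by blast
  define T where "T = max 1 N"
  have T: "T \<ge> 1" "T \<ge> N" "\<omega> T \<ge> 0"
    using general_weight_functionD(2)[OF \<omega>, of T] by (auto simp: T_def)
  have "\<omega> t \<le> (c + \<omega> T) * t\<^sup>2" if t: "t \<ge> 1" for t
  proof -
    have t2: "1 \<le> t\<^sup>2" using t by (simp add: one_le_power)
    have "\<omega> t \<le> c * t\<^sup>2 + \<omega> T"
    proof (cases "t \<ge> T")
      case True
      then show ?thesis using N[of t] T by simp
    next
      case False
      have "0 \<le> c * t\<^sup>2" using c by simp
      then show ?thesis using general_weight_functionD(1)[OF \<omega>, of t T] False t by linarith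
    qed
    moreover have "\<omega> T * 1 \<le> \<omega> T * t\<^sup>2" using T(3) t2 by (rule mult_left_mono[rotated])
    ultimately show ?thesis by (simp add: algebra_simps)
  qed
  moreover have "c + \<omega> T > 0" using c T by linarith
  ultimately show ?thesis by blast
qed

lemma weight_matrix_absorbs_powers:
  assumes \<omega>: "general_weight_function \<omega>" and "\<mu> > 0"
  shows "\<exists>\<kappa>>0. \<exists>K>0. \<forall>n. (2 ^ j) ^ n * weight_matrix \<omega> \<mu> n \<le> K * weight_matrix \<omega> \<kappa> n"
proof (induction j)
  case 0
  show ?case using assms(2) by (intro exI[of _ \<mu>] conjI exI[of _ 1]) auto
next
  case (Suc j)
  then obtain \<kappa> K where *: "\<kappa> > 0" "K > 0"
    "\<And>n. (2 ^ j) ^ n * weight_matrix \<omega> \<mu> n \<le> K * weight_matrix \<omega> \<kappa> n" by blast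
  obtain L where L: "L > 0" "\<And>\<mu> n. \<mu> > 0 \<Longrightarrow>
      2 ^ n * weight_matrix \<omega> \<mu> n \<le> exp (1 / \<mu>) * weight_matrix \<omega> (L * \<mu>) n"
    using weight_matrix_absorbs_power_of_2[OF \<omega>] by blast
  have "(2 ^ Suc j) ^ n * weight_matrix \<omega> \<mu> n \<le> K * exp (1 / \<kappa>) * weight_matrix \<omega> (L * \<kappa>) n" for n
  proof -
    have "(2 ^ Suc j) ^ n * weight_matrix \<omega> \<mu> n = 2 ^ n * ((2 ^ j) ^ n * weight_matrix \<omega> \<mu> n)"
      by (simp add: power_mult_distrib)
    also have "\<dots> \<le> 2 ^ n * (K * weight_matrix \<omega> \<kappa> n)"
      using * by (intro mult_left_mono) auto
    also have "\<dots> = K * (2 ^ n * weight_matrix \<omega> \<kappa> n)" by simp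
    also have "\<dots> \<le> K * (exp (1 / \<kappa>) * weight_matrix \<omega> (L * \<kappa>) n)"
      using * L by (intro mult_left_mono) auto
    finally show ?thesis by (simp add: mult.assoc)
  qed
  moreover have "L * \<kappa> > 0" "K * exp (1 / \<kappa>) > 0" using L * by auto
  ultimately show ?case by blast
qed

text \<open>Condition \<open>(\<beta>)\<close> enters here: if \<open>\<omega>(t) \<le> A t\<^sup>2\<close> then for \<open>\<mu> = 2 A\<close> the moments \<open>r\<^sup>n e\<^bsup>-r\<^sup>2/2\<^esup>\<close>
  of the Gaussian are bounded by the weight matrix, as \<open>r\<^sup>n \<le> e\<^bsup>\<omega>(r)/\<mu>\<^esup> W\<^sub>n\<close> for \<open>r \<ge> 1\<close>. The factor \<open>2\<close> takes
  care of \<open>r < 1\<close>, where the moment is at most \<open>1\<close> and \<open>W\<^sub>n \<ge> e\<^bsup>-1/2\<^esup>\<close>.\<close>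

lemma gaussian_moment_le_weight_matrix:
  assumes \<omega>: "general_weight_function \<omega>" and A: "A > 0" "\<And>t. t \<ge> 1 \<Longrightarrow> \<omega> t \<le> A * t\<^sup>2"
    and r: "r \<ge> 0"
  shows "r ^ n * exp (- r\<^sup>2 / 2) \<le> 2 * weight_matrix \<omega> (2 * A) n"
proof -
  have W: "q ^ n * exp (- q\<^sup>2 / 2) \<le> weight_matrix \<omega> (2 * A) n" if q: "q \<ge> 1" for q
  proof -
    have "q ^ n \<le> exp (\<omega> q / (2 * A)) * weight_matrix \<omega> (2 * A) n"
      using A q by (intro power_le_weight_matrix \<omega>) auto
    also have "\<dots> \<le> exp (q\<^sup>2 / 2) * weight_matrix \<omega> (2 * A) n"
      using A(1) A(2)[OF q] weight_matrix_pos[of \<omega> "2 * A" n]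
      by (intro mult_right_mono) (auto simp: field_simps)
    finally have "q ^ n * exp (- q\<^sup>2 / 2)
        \<le> exp (q\<^sup>2 / 2) * weight_matrix \<omega> (2 * A) n * exp (- q\<^sup>2 / 2)"
      by (rule mult_right_mono) simp
    then show ?thesis by (simp add: exp_minus field_simps)
  qed
  show ?thesis
  proof (cases "r \<ge> 1")
    case True
    then show ?thesis using W[of r] weight_matrix_pos[of \<omega> "2 * A" n] by linarith
  next
    case False
    have "exp (1 / 2) \<le> (2 :: real)" using exp_bound_half[of "1 / 2 :: real"] by simp
    then have "1 / 2 \<le> exp (- (1 / 2) :: real)" by (simp add: exp_minus field_simps)
    then have "1 / 2 \<le> weight_matrix \<omega> (2 * A) n" using W[of 1] by simp
    moreover have "r ^ n * exp (- r\<^sup>2 / 2) \<le> 1 * 1"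
      using False r by (intro mult_mono power_le_one) auto
    ultimately show ?thesis by simp
  qed
qed

text \<open>The choice \<open>s = sqrt k\<close> leaves \<open>(\<nu> + \<bar>x\<bar> + sqrt k)\<^sup>k e\<^bsup>-x\<^sup>2/2\<^esup>\<close>, which splits into three powers at
  the price of \<open>3\<^sup>k\<close>. The power of \<open>\<nu>\<close> is bounded by \<open>e\<^bsup>\<omega>(\<nu>)/\<mu>\<^esup> W\<^sub>k\<close>, the power of \<open>\<bar>x\<bar>\<close> is a Gaussian moment,
  and \<open>(sqrt k)\<^sup>k\<close> is \<open>e\<^bsup>k/2\<^esup>\<close> times the Gaussian moment at the point \<open>sqrt k\<close>. Supermultiplicativity
  recombines the products, and the geometric factors go into a larger parameter.\<close>

lemma modulated_gaussian_deriv_bound: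
  assumes "weight_function \<omega>"
  shows "\<exists>\<mu>>0. \<exists>\<kappa>>0. \<exists>K>0. \<forall>\<nu>\<ge>1. \<forall>k a x.
    \<bar>x\<bar> ^ a * cmod (modulated_gaussian_deriv \<nu> k x)
      \<le> K * exp (\<omega> \<nu> / \<mu>) * weight_matrix \<omega> \<kappa> (a + k)"
proof -
  have \<omega>: "general_weight_function \<omega>" using assms by (simp add: weight_function_def)
  obtain A where A: "A > 0" "\<And>t. t \<ge> 1 \<Longrightarrow> \<omega> t \<le> A * t\<^sup>2"
    using weight_function_le_square[OF assms] by blast
  define \<mu> where "\<mu> = 2 * A"
  have \<mu>: "\<mu> > 0" using A by (simp add: \<mu>_def)
  define W where "W = weight_matrix \<omega> \<mu>"
  have W: "W n > 0" "W m * W n \<le> W (m + n)" for m n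
    using weight_matrix_pos weight_matrix_supermult[OF \<omega> \<mu>] by (auto simp: W_def)
  have moment: "r ^ n * exp (- r\<^sup>2 / 2) \<le> 2 * W n" if "r \<ge> 0" for r n
    using gaussian_moment_le_weight_matrix[OF \<omega> A that] by (simp add: W_def \<mu>_def)
  have half: "exp (1 / 2) \<le> (2 :: real)" using exp_bound_half[of "1 / 2 :: real"] by simp
  obtain \<kappa> K where \<kappa>: "\<kappa> > 0" "K > 0" "\<And>n. (2 ^ 3) ^ n * W n \<le> K * weight_matrix \<omega> \<kappa> n"
    using weight_matrix_absorbs_powers[OF \<omega> \<mu>, of 3] unfolding W_def by blast
  have "\<bar>x\<bar> ^ a * cmod (modulated_gaussian_deriv \<nu> k x)
      \<le> (8 * K) * exp (\<omega> \<nu> / \<mu>) * weight_matrix \<omega> \<kappa> (a + k)" if \<nu>: "\<nu> \<ge> 1" for \<nu> k a x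
  proof -
    let ?e = "exp (- x\<^sup>2 / 2)" and ?E = "exp (\<omega> \<nu> / \<mu>)" and ?s = "sqrt (real k)"
    have E: "?E \<ge> 1" using general_weight_functionD(2)[OF \<omega>, of \<nu>] \<nu> \<mu> by simp
    have xa: "\<bar>x\<bar> ^ a * ?e \<le> 2 * W a" and xak: "\<bar>x\<bar> ^ (a + k) * ?e \<le> 2 * W (a + k)"
      using moment[of "\<bar>x\<bar>"] by simp_all
    have EW: "W (a + k) \<le> ?E * W (a + k)" using mult_right_mono[OF E less_imp_le[OF W(1)]] by (simp only: mult_1_left)
    have "\<nu> ^ k * (\<bar>x\<bar> ^ a * ?e) \<le> (?E * W k) * (2 * W a)"
      using W(1)[of k] by (intro mult_mono[OF _ xa]) (simp_all add: W_def power_le_weight_matrix \<omega> \<mu> \<nu>)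
    also have "\<dots> = 2 * ?E * (W a * W k)" by simp
    also have "\<dots> \<le> 2 * ?E * W (a + k)" using W by (intro mult_left_mono) auto
    finally have t1: "\<nu> ^ k * (\<bar>x\<bar> ^ a * ?e) \<le> 2 * ?E * W (a + k)" .
    have t2: "\<bar>x\<bar> ^ k * (\<bar>x\<bar> ^ a * ?e) \<le> 2 * ?E * W (a + k)"
      using xak EW by (simp add: power_add mult_ac)
    have "?s ^ k * exp (- real k / 2) \<le> 2 * W k" using moment[of ?s k] by simp
    then have "?s ^ k \<le> exp (k / 2) * (2 * W k)" by (simp add: exp_minus field_simps)
    also have "exp (k / 2) = exp (1 / 2) ^ k" by (simp flip: exp_of_nat_mult)
    also have "\<dots> * (2 * W k) \<le> 2 ^ k * (2 * W k)"
      using half W(1)[of k] by (intro mult_right_mono power_mono) auto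
    finally have "?s ^ k \<le> 2 ^ k * (2 * W k)" .
    then have "?s ^ k * (\<bar>x\<bar> ^ a * ?e) \<le> (2 ^ k * (2 * W k)) * (2 * W a)"
      using W(1)[of k] by (intro mult_mono[OF _ xa]) (simp_all add: less_imp_le)
    also have "\<dots> = 4 * 2 ^ k * (W a * W k)" by simp
    also have "\<dots> \<le> 4 * 2 ^ k * W (a + k)" using W by (intro mult_left_mono) auto
    also have "\<dots> \<le> 4 * 2 ^ k * (?E * W (a + k))" using EW by (intro mult_left_mono) auto
    finally have t3: "?s ^ k * (\<bar>x\<bar> ^ a * ?e) \<le> 4 * 2 ^ k * (?E * W (a + k))" .
    have "\<bar>x\<bar> ^ a * cmod (modulated_gaussian_deriv \<nu> k x)
        \<le> \<bar>x\<bar> ^ a * ((\<nu> + \<bar>x\<bar> + ?s) ^ k * ?e)"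
      using \<nu> by (intro mult_left_mono cmod_modulated_gaussian_deriv_le) auto
    also have "\<dots> \<le> \<bar>x\<bar> ^ a * ((3 ^ k * (\<nu> ^ k + \<bar>x\<bar> ^ k + ?s ^ k)) * ?e)"
      using \<nu> by (intro mult_left_mono mult_right_mono power_sum3_le) auto
    also have "\<dots> = 3 ^ k * (\<nu> ^ k * (\<bar>x\<bar> ^ a * ?e) + \<bar>x\<bar> ^ k * (\<bar>x\<bar> ^ a * ?e) + ?s ^ k * (\<bar>x\<bar> ^ a * ?e))"
      by (simp add: algebra_simps)
    also have "\<dots> \<le> 3 ^ k * (2 * ?E * W (a + k) + 2 * ?E * W (a + k) + 4 * 2 ^ k * (?E * W (a + k)))"
      by (intro mult_left_mono add_mono t1 t2 t3) simp
    also have "\<dots> = 3 ^ k * (4 + 4 * 2 ^ k) * (?E * W (a + k))" by (simp add: algebra_simps)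
    also have "\<dots> \<le> (8 * 8 ^ (a + k)) * (?E * W (a + k))"
    proof (rule mult_right_mono)
      have "3 ^ k * (4 + 4 * 2 ^ k) \<le> 3 ^ k * (8 * 2 ^ k :: real)" by (intro mult_left_mono) auto
      also have "\<dots> = 8 * 6 ^ k" by (simp flip: power_mult_distrib)
      also have "(6::real) ^ k \<le> 8 ^ k" by (intro power_mono) auto
      also have "(8::real) ^ k \<le> 8 ^ (a + k)" by (intro power_increasing) auto
      finally show "3 ^ k * (4 + 4 * 2 ^ k) \<le> (8 * 8 ^ (a + k) :: real)" by simp
    qed (use W(1) in \<open>simp add: less_imp_le\<close>)
    also have "\<dots> = 8 * ?E * ((2 ^ 3) ^ (a + k) * W (a + k))" by simp
    also have "\<dots> \<le> 8 * ?E * (K * weight_matrix \<omega> \<kappa> (a + k))"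
      by (intro mult_left_mono \<kappa>(3)) simp
    finally show ?thesis by (simp add: mult_ac)
  qed
  moreover have "8 * K > 0" using \<kappa> by simp
  ultimately show ?thesis using \<mu> \<kappa>(1) by blast
qed

section \<open>A test function that detects the weight\<close>

lemma has_vector_derivative_suminf:
  fixes f f' :: "nat \<Rightarrow> real \<Rightarrow> complex"
  assumes deriv: "\<And>n x. (f n has_vector_derivative f' n x) (at x)"
    and bound: "\<And>n x. norm (f' n x) \<le> M n" and M: "summable M"
    and summ: "\<And>x. summable (\<lambda>n. f n x)"
  shows "((\<lambda>x. \<Sum>n. f n x) has_vector_derivative (\<Sum>n. f' n x)) (at x)"
proof -
  have unif: "uniform_limit UNIV (\<lambda>n x. \<Sum>i<n. f' i x) (\<lambda>x. \<Sum>n. f' n x) sequentially"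
    by (rule Weierstrass_m_test[OF bound M])
  have "\<exists>g. \<forall>x\<in>UNIV. (\<lambda>n. f n x) sums (g x) \<and>
      (g has_derivative (\<lambda>h. h *\<^sub>R (\<Sum>n. f' n x))) (at x within UNIV)"
  proof (rule has_derivative_series)
    fix e :: real assume "e > 0"
    then have "\<forall>\<^sub>F n in sequentially. \<forall>x\<in>UNIV. dist (\<Sum>i<n. f' i x) (\<Sum>n. f' n x) < e"
      by (rule uniform_limitD[OF unif])
    then show "\<forall>\<^sub>F n in sequentially. \<forall>x\<in>UNIV. \<forall>h.
        norm ((\<Sum>i<n. h *\<^sub>R f' i x) - h *\<^sub>R (\<Sum>n. f' n x)) \<le> e * norm h"
    proof eventually_elim
      case (elim n)
      have "norm ((\<Sum>i<n. h *\<^sub>R f' i x) - h *\<^sub>R (\<Sum>n. f' n x)) \<le> e * norm h" for x h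
      proof -
        have "norm ((\<Sum>i<n. h *\<^sub>R f' i x) - h *\<^sub>R (\<Sum>n. f' n x))
            = norm h * dist (\<Sum>i<n. f' i x) (\<Sum>n. f' n x)"
          by (simp add: dist_norm flip: scaleR_sum_right scaleR_diff_right)
        also have "\<dots> \<le> norm h * e" using elim by (intro mult_left_mono) (auto simp: less_imp_le)
        finally show ?thesis by (simp add: mult.commute)
      qed
      then show ?case by blast
    qed
  next
    show "(\<lambda>n. f n 0) sums (\<Sum>n. f n 0)" using summ by (rule summable_sums)
  qed (use deriv in \<open>auto simp: has_vector_derivative_def\<close>)
  then obtain g where g: "\<And>x. (\<lambda>n. f n x) sums g x"
      "\<And>x. (g has_derivative (\<lambda>h. h *\<^sub>R (\<Sum>n. f' n x))) (at x)" by auto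
  have "g = (\<lambda>x. \<Sum>n. f n x)" using sums_unique[OF g(1)] by auto
  then show ?thesis using g(2) by (simp add: has_vector_derivative_def)
qed

text \<open>A function on the line as a function on \<open>\<real>\<^sup>1\<close>, extended by the value \<open>0\<close> that elements of
  \<open>C_infinity\<close> have off the space. The extension commutes with differentiation everywhere.\<close>

definition line_function :: "(real \<Rightarrow> complex) \<Rightarrow> (nat \<Rightarrow> real) \<Rightarrow> complex" where
  "line_function F x = (if x \<in> topspace (Euclidean_space 1) then F (x 0) else 0)"

lemma partial_deriv_line_function:
  assumes "\<And>t. (F has_vector_derivative F' t) (at t)"
  shows "partial_deriv 0 (line_function F) = line_function F'"
proof
  fix x :: "nat \<Rightarrow> real"
  show "partial_deriv 0 (line_function F) x = line_function F' x"
  proof (cases "x \<in> topspace (Euclidean_space 1)")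
    case True
    then have "(\<lambda>t. line_function F (x(0 := t))) = F"
      using fun_upd_in_Euclidean_space[OF True] by (auto simp: line_function_def)
    then show ?thesis
      using True vector_derivative_at[OF assms] by (simp add: partial_deriv_def line_function_def)
  next
    case False
    then have "x(0 := t) \<notin> topspace (Euclidean_space 1)" for t
      by (auto simp: topspace_Euclidean_space)
    then have "(\<lambda>t. line_function F (x(0 := t))) = (\<lambda>_. 0)" by (simp add: line_function_def)
    then show ?thesis using False by (simp add: partial_deriv_def line_function_def)
  qed
qed

lemma multi_deriv_line_function:
  assumes "\<And>k t. (F k has_vector_derivative F (Suc k) t) (at t)"
  shows "multi_deriv 1 \<beta> (line_function (F 0)) = line_function (F (\<beta> 0))"
proof -
  have "(partial_deriv 0 ^^ k) (line_function (F 0)) = line_function (F k)" for k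
    by (induction k) (simp_all add: partial_deriv_line_function[OF assms])
  then show ?thesis by (simp add: multi_deriv_def)
qed

lemma line_function_in_C_infinity:
  assumes "\<And>k t. (F k has_vector_derivative F (Suc k) t) (at t)"
  shows "line_function (F 0) \<in> C_infinity 1"
proof -
  have "C_k 1 k (line_function (F n))" for k n
  proof (induction k arbitrary: n)
    case 0
    have F: "continuous_on UNIV (F n)"
      by (intro continuous_at_imp_continuous_on ballI has_vector_derivative_continuous[OF assms])
    have proj: "continuous_on (topspace (Euclidean_space 1)) (\<lambda>x :: nat \<Rightarrow> real. x 0)"
      by (rule continuous_on_subset[OF continuous_on_product_coordinates]) simp
    have "continuous_on (topspace (Euclidean_space 1)) (\<lambda>x. F n (x 0))"
      by (rule continuous_on_compose2[OF F proj]) simp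
    then have "continuous_on (topspace (Euclidean_space 1)) (line_function (F n))"
      by (rule continuous_on_eq) (simp add: line_function_def)
    then show ?case by (simp add: continuous_map_Euclidean_space_iff)
  next
    case (Suc k)
    have "(\<lambda>t. line_function (F n) (x(0 := t))) differentiable at (x 0)"
      if x: "x \<in> topspace (Euclidean_space 1)" for x
    proof -
      have "(\<lambda>t. line_function (F n) (x(0 := t))) = F n"
        using fun_upd_in_Euclidean_space[OF x] by (auto simp: line_function_def)
      then show ?thesis by (simp add: differentiableI_vector[OF assms])
    qed
    moreover have "continuous_map (Euclidean_space 1) euclidean (line_function (F n))"
      using Suc.IH[of n] by (cases k) simp_all
    ultimately show ?case
      using Suc.IH[of "Suc n"] by (simp add: partial_deriv_line_function[OF assms])
  qed
  then show ?thesis by (auto simp: C_infinity_def line_function_def)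
qed

text \<open>The function is \<open>\<Sum>\<^sub>n c\<^sub>n exp(i n x - x\<^sup>2 / 2)\<close> with \<open>c\<^sub>n = e\<^bsup>-\<omega>(n)/\<mu>\<^esup> / n\<^sup>2\<close>. The exponential
  factor pays for the growth in \<open>n\<close> of the bounds on the derivatives, and \<open>1 / n\<^sup>2\<close> makes the series
  converge while costing only \<open>2 ln n = o(\<omega>(n))\<close> in the exponent. Since nothing
  cancels at the origin, every single frequency is visible in every derivative there.\<close>

lemma exists_test_function:
  assumes "weight_function \<omega>"
  shows "\<exists>\<mu>>0. \<exists>f\<in>GS_space Joint \<omega> 1. \<forall>m\<ge>1. \<forall>\<beta>.
    exp (- \<omega> (real m) / \<mu>) / (real m)\<^sup>2 * real m ^ \<beta> 0 \<le> cmod (multi_deriv 1 \<beta> f (\<lambda>_. 0))"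
proof -
  obtain \<mu> \<kappa> K where \<mu>: "\<mu> > 0" and \<kappa>: "\<kappa> > 0" and K: "K > 0"
    and bound: "\<forall>\<nu>\<ge>1. \<forall>k a x. \<bar>x\<bar> ^ a * cmod (modulated_gaussian_deriv \<nu> k x)
      \<le> K * exp (\<omega> \<nu> / \<mu>) * weight_matrix \<omega> \<kappa> (a + k)"
    using modulated_gaussian_deriv_bound[OF assms] by (elim exE conjE) (rule that)
  (* division by zero gives the coefficient 0 to the frequency n = 0 *)
  define c where "c = (\<lambda>n. exp (- \<omega> (real n) / \<mu>) / (real n)\<^sup>2)"
  have c: "c n \<ge> 0" for n by (simp add: c_def)
  define g where "g = (\<lambda>k n x. complex_of_real (c n) * modulated_gaussian_deriv (real n) k x)"
  define F where "F = (\<lambda>k x. \<Sum>n. g k n x)"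
  have g: "\<bar>x\<bar> ^ a * cmod (g k n x) \<le> K * weight_matrix \<omega> \<kappa> (a + k) * (1 / (real n)\<^sup>2)" for a k n x
  proof (cases "n = 0")
    case False
    have "\<bar>x\<bar> ^ a * cmod (g k n x) = c n * (\<bar>x\<bar> ^ a * cmod (modulated_gaussian_deriv (real n) k x))"
      using c[of n] by (simp add: g_def norm_mult)
    also have "\<dots> \<le> c n * (K * exp (\<omega> (real n) / \<mu>) * weight_matrix \<omega> \<kappa> (a + k))"
      using False by (intro mult_left_mono bound[rule_format] c) simp
    also have "\<dots> = K * weight_matrix \<omega> \<kappa> (a + k) * (1 / (real n)\<^sup>2)"
      by (simp add: c_def exp_minus)
    finally show ?thesis .
  qed (simp add: g_def c_def)
  have sq: "summable (\<lambda>n. 1 / (real n)\<^sup>2)"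
    using inverse_power_summable[of 2, where ?'a = real] by (simp add: inverse_eq_divide)
  have M: "summable (\<lambda>n. K * weight_matrix \<omega> \<kappa> (a + k) * (1 / (real n)\<^sup>2))" for a k
    by (rule summable_mult[OF sq])
  have summ: "summable (\<lambda>n. cmod (g k n x))" for k x
    using g[of x 0 k] by (intro summable_comparison_test'[OF M[of 0 k], of 0]) auto
  have deriv: "(F k has_vector_derivative F (Suc k) x) (at x)" for k x
    unfolding F_def
  proof (rule has_vector_derivative_suminf)
    show "(g k n has_vector_derivative g (Suc k) n x) (at x)" for n x
      unfolding g_def
      by (intro has_vector_derivative_mult_right has_vector_derivative_modulated_gaussian_deriv)
    show "norm (g (Suc k) n x) \<le> K * weight_matrix \<omega> \<kappa> (0 + Suc k) * (1 / (real n)\<^sup>2)" for n x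
      using g[of x 0 "Suc k" n] by simp
    show "summable (\<lambda>n. K * weight_matrix \<omega> \<kappa> (0 + Suc k) * (1 / (real n)\<^sup>2))" by (rule M)
    show "summable (\<lambda>n. g k n x)" for x by (rule summable_norm_cancel[OF summ])
  qed
  define f where "f = line_function (F 0)"
  have mderiv: "multi_deriv 1 \<beta> f = line_function (F (\<beta> 0))" for \<beta>
    unfolding f_def using deriv by (rule multi_deriv_line_function)
  have "\<bar>x\<bar> ^ a * cmod (F k x) \<le> weight_matrix \<omega> \<kappa> (a + k) * (K * (\<Sum>n. 1 / (real n)\<^sup>2))" for a k x
  proof -
    have "\<bar>x\<bar> ^ a * cmod (F k x) \<le> \<bar>x\<bar> ^ a * (\<Sum>n. cmod (g k n x))"
      unfolding F_def by (intro mult_left_mono summable_norm summ) simp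
    also have "\<dots> = (\<Sum>n. \<bar>x\<bar> ^ a * cmod (g k n x))" by (rule suminf_mult[OF summ, symmetric])
    also have "\<dots> \<le> (\<Sum>n. K * weight_matrix \<omega> \<kappa> (a + k) * (1 / (real n)\<^sup>2))"
      by (intro suminf_le g summable_mult summ M)
    also have "\<dots> = K * weight_matrix \<omega> \<kappa> (a + k) * (\<Sum>n. 1 / (real n)\<^sup>2)"
      by (rule suminf_mult[OF sq])
    finally show ?thesis by (simp add: mult_ac)
  qed
  then have "GS_norm Joint \<omega> 1 \<kappa> f \<le> ennreal (K * (\<Sum>n. 1 / (real n)\<^sup>2))"
    unfolding GS_norm_le_iff mderiv
    using weight_matrix_pos[of \<omega> \<kappa>]
    by (auto simp: line_function_def monomial_def multi_length_def norm_mult norm_power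
        less_imp_le simp flip: ennreal_mult' intro!: ennreal_leI)
  then have "GS_norm Joint \<omega> 1 \<kappa> f < \<infinity>" by (rule order.strict_trans1) simp
  then have "f \<in> GS_space Joint \<omega> 1"
    using \<kappa> line_function_in_C_infinity[of F, OF deriv] by (auto simp: GS_space_def GS_step_def f_def)
  moreover have "c m * real m ^ \<beta> 0 \<le> cmod (multi_deriv 1 \<beta> f (\<lambda>_. 0))" for m \<beta>
  proof -
    let ?k = "\<beta> 0"
    have "\<forall>n. \<exists>r\<ge>real n ^ ?k. modulated_gaussian_deriv (real n) ?k 0 = \<i> ^ ?k * of_real r"
      using modulated_gaussian_deriv_0_ge by simp
    then obtain r where r: "\<And>n. r n \<ge> real n ^ ?k"
      "\<And>n. modulated_gaussian_deriv (real n) ?k 0 = \<i> ^ ?k * of_real (r n)"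
      by metis
    have r0: "r n \<ge> 0" for n using r(1)[of n] zero_le_power[of "real n" ?k] by linarith
    have cr: "summable (\<lambda>n. c n * r n)"
      using summ[of ?k 0] c r0 by (simp add: g_def r(2) norm_mult norm_power)
    have "F ?k 0 = (\<Sum>n. \<i> ^ ?k * of_real (c n * r n))"
      unfolding F_def g_def r(2) by (simp add: mult_ac)
    also have "\<dots> = \<i> ^ ?k * of_real (\<Sum>n. c n * r n)"
      using cr by (simp add: suminf_mult summable_of_real suminf_of_real del: of_real_mult)
    finally have "cmod (F ?k 0) = \<bar>\<Sum>n. c n * r n\<bar>"
      by (simp add: norm_mult norm_power)
    moreover have "c m * r m \<le> (\<Sum>n. c n * r n)"
      using sum_le_suminf[OF cr, of "{m}"] c r0 by simp
    moreover have "c m * real m ^ ?k \<le> c m * r m" by (intro mult_left_mono r c)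
    ultimately have "c m * real m ^ ?k \<le> cmod (F ?k 0)" by linarith
    then show ?thesis
      unfolding mderiv by (simp add: line_function_def topspace_Euclidean_space)
  qed
  ultimately show ?thesis
    using \<mu> by (intro exI[of _ \<mu>] conjI bexI[of _ f] allI impI) (simp_all add: c_def)
qed

text \<open>Comparing the lower bound of the test function at the origin with the bound that membership
  in the space of \<open>\<sigma>\<close> gives there shows that the powers \<open>m\<^sup>k\<close> of every integer are controlled by the
  weight matrix of \<open>\<sigma>\<close>, with a constant that is polynomial in \<open>m\<close> times \<open>e\<^bsup>\<omega>(m)/\<mu>\<^esup>\<close>.\<close>

lemma weight_preceq_of_GS_space_subset:
  assumes \<omega>': "weight_function \<omega>" and \<sigma>: "general_weight_function \<sigma>"
    and sub: "GS_space G \<omega> 1 \<subseteq> GS_space H \<sigma> 1"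
  shows "\<omega> \<preceq>\<^sub>w \<sigma>"
proof -
  have \<omega>: "general_weight_function \<omega>" using \<omega>' by (simp add: weight_function_def)
  have refl: "\<rho> \<preceq>\<^sub>w \<rho>" for \<rho> by (simp add: weight_preceq_def)
  obtain \<mu> f where \<mu>: "\<mu> > 0" and f: "f \<in> GS_space Joint \<omega> 1"
    and lower: "\<And>m \<beta>. m \<ge> 1 \<Longrightarrow>
      exp (- \<omega> (real m) / \<mu>) / (real m)\<^sup>2 * real m ^ \<beta> 0 \<le> cmod (multi_deriv 1 \<beta> f (\<lambda>_. 0))"
    using exists_test_function[OF \<omega>'] by (elim exE conjE bexE) (rule that, auto)
  have "f \<in> GS_space Joint \<sigma> 1"
    using f sub GS_space_mono[OF \<omega> \<omega> refl] GS_space_mono[OF \<sigma> \<sigma> refl] by blast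
  then obtain \<kappa> where \<kappa>: "\<kappa> > 0" and fin: "GS_norm Joint \<sigma> 1 \<kappa> f < \<infinity>"
    by (auto simp: GS_space_def GS_step_def)
  then obtain N where N: "N \<ge> 0" "GS_norm Joint \<sigma> 1 \<kappa> f = ennreal N"
    by (cases "GS_norm Joint \<sigma> 1 \<kappa> f") auto
  have upper: "cmod (multi_deriv 1 (\<lambda>i. if i = 0 then k else 0) f (\<lambda>_. 0)) \<le> N * weight_matrix \<sigma> \<kappa> k" for k
  proof -
    let ?\<beta> = "\<lambda>i::nat. if i = 0 then k else 0"
    have "ennreal (cmod (of_real (monomial 1 (\<lambda>_. 0) (\<lambda>_. 0)) * multi_deriv 1 ?\<beta> f (\<lambda>_. 0)))
        \<le> ennreal (growth_weight Joint \<sigma> 1 \<kappa> (\<lambda>_. 0) ?\<beta>) * GS_norm Joint \<sigma> 1 \<kappa> f"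
      by (rule cmod_le_GS_norm) (auto simp: multi_indices_def topspace_Euclidean_space)
    then show ?thesis
      using N weight_matrix_pos[of \<sigma> \<kappa> k]
      by (simp add: monomial_def multi_length_def less_imp_le mult.commute flip: ennreal_mult')
  qed
  obtain A where A: "A \<ge> 0" "\<And>t. t \<ge> 1 \<Longrightarrow> ln t \<le> 1 * \<omega> t + A"
    using ln_le_weight[OF \<omega>, of 1] by auto
  obtain L where L: "L \<ge> 1" "\<And>t. t \<ge> 0 \<Longrightarrow> \<omega> (2 * t) \<le> L * (\<omega> t + 1)"
    using general_weight_functionD(5)[OF \<omega>] by auto
  define P where "P = \<kappa> / \<mu> + 3 * \<kappa>"
  define Q where "Q = 3 * \<kappa> * A + \<kappa> * ln (max N 1)"
  have P: "P > 0" using \<kappa> \<mu> by (simp add: P_def add_pos_pos)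
  have Q: "Q \<ge> 0" using \<kappa> A by (simp add: Q_def)
  have at_nat: "\<sigma> (real m) \<le> P * \<omega> (real m) + Q" if m: "m \<ge> 1" for m
  proof -
    let ?c = "exp (- \<omega> (real m) / \<mu>) / (real m)\<^sup>2"
    have c: "?c > 0" using m by simp
    have "real m ^ k \<le> max N 1 / ?c * weight_matrix \<sigma> \<kappa> k" for k
    proof -
      have "?c * real m ^ k \<le> N * weight_matrix \<sigma> \<kappa> k"
        using lower[OF m, of "\<lambda>i. if i = 0 then k else 0"] upper[of k] by simp
      also have "\<dots> \<le> max N 1 * weight_matrix \<sigma> \<kappa> k"
        using weight_matrix_pos[of \<sigma> \<kappa> k] by (intro mult_right_mono) auto
      finally have "real m ^ k \<le> (max N 1 * weight_matrix \<sigma> \<kappa> k) / ?c"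
        by (subst pos_le_divide_eq[OF c]) (simp only: mult.commute)
      then show ?thesis by (simp only: times_divide_eq_left)
    qed
    moreover have "max N 1 / ?c > 0" by (rule divide_pos_pos[OF _ c]) simp
    ultimately have "\<sigma> (real m) \<le> \<kappa> * ln (real m) + \<kappa> * ln (max N 1 / ?c)"
      using m by (intro weight_le_of_moment_bounds \<sigma> \<kappa>) auto
    also have "ln (max N 1 / ?c) = ln (max N 1) - ln ?c"
      by (rule ln_divide_pos[OF _ c]) simp
    also have "ln ?c = - \<omega> (real m) / \<mu> - 2 * ln (real m)"
      using m by (simp add: ln_divide_pos ln_realpow)
    finally have "\<sigma> (real m) \<le> 3 * \<kappa> * ln (real m) + \<kappa> / \<mu> * \<omega> (real m) + \<kappa> * ln (max N 1)"
      by (simp add: algebra_simps)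
    also have "3 * \<kappa> * ln (real m) \<le> 3 * \<kappa> * (1 * \<omega> (real m) + A)"
      using A(2)[of "real m"] m \<kappa> by (intro mult_left_mono) auto
    finally show ?thesis by (simp add: P_def Q_def algebra_simps)
  qed
  have "\<sigma> t \<le> (P * L + Q) * \<omega> t + (P * L + Q)" if t: "t \<ge> 1" for t
  proof -
    define m where "m = nat \<lceil>t\<rceil>"
    have m: "t \<le> real m" "real m \<le> 2 * t" "m \<ge> 1" using t by (auto simp: m_def) linarith+
    have "\<sigma> t \<le> \<sigma> (real m)" using general_weight_functionD(1)[OF \<sigma>] t m by simp
    also have "\<dots> \<le> P * \<omega> (real m) + Q" by (rule at_nat[OF m(3)])
    also have "\<omega> (real m) \<le> \<omega> (2 * t)" using general_weight_functionD(1)[OF \<omega>] t m by simp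
    also have "\<omega> (2 * t) \<le> L * (\<omega> t + 1)" using L t by simp
    finally have "\<sigma> t \<le> P * (L * (\<omega> t + 1)) + Q" using P by simp
    moreover have "0 \<le> Q * \<omega> t" using Q general_weight_functionD(2)[OF \<omega>, of t] t by simp
    ultimately show ?thesis by (simp add: algebra_simps)
  qed
  moreover have "P * L + Q > 0" using P L Q by (simp add: add_pos_nonneg)
  ultimately show ?thesis unfolding weight_preceq_iff[OF \<omega> \<sigma>] by blast
qed

theorem theorem6p3:
  fixes \<omega> \<sigma> :: "real \<Rightarrow> real" and G H :: growth
  shows "(weight_function \<omega> \<and> non_quasianalytic \<omega> \<and> general_weight_function \<sigma> \<longrightarrow>
            (\<omega> \<preceq>\<^sub>w \<sigma> \<longleftrightarrow>
              (\<forall>d\<ge>1. GS_space G \<omega> d \<subseteq> GS_space H \<sigma> d \<and>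
                     continuous_map (GS_topology G \<omega> d) (GS_topology H \<sigma> d) (\<lambda>f. f))) \<and>
            (GS_space G \<omega> 1 \<subseteq> GS_space H \<sigma> 1 \<longrightarrow> \<omega> \<preceq>\<^sub>w \<sigma>)) \<and>
         (general_weight_function \<omega> \<and> general_weight_function \<sigma> \<longrightarrow>
            \<omega> \<preceq>\<^sub>w \<sigma> \<longrightarrow>
              (\<forall>d\<ge>1. GS_space G \<omega> d \<subseteq> GS_space H \<sigma> d \<and>
                     continuous_map (GS_topology G \<omega> d) (GS_topology H \<sigma> d) (\<lambda>f. f)))"
proof -
  have inclusion: "\<forall>d\<ge>1. GS_space G \<omega> d \<subseteq> GS_space H \<sigma> d \<and>
      continuous_map (GS_topology G \<omega> d) (GS_topology H \<sigma> d) (\<lambda>f. f)"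
    if "general_weight_function \<omega>" "general_weight_function \<sigma>" "\<omega> \<preceq>\<^sub>w \<sigma>"
    using GS_space_mono[OF that] continuous_map_GS_topology[OF that] by blast
  moreover have "\<omega> \<preceq>\<^sub>w \<sigma>"
    if "weight_function \<omega>" "general_weight_function \<sigma>" "GS_space G \<omega> 1 \<subseteq> GS_space H \<sigma> 1"
    using that by (rule weight_preceq_of_GS_space_subset)
  moreover have "general_weight_function \<omega>" if "weight_function \<omega>"
    using that by (simp add: weight_function_def)
  ultimately show ?thesis by (meson order_refl)
qed

end
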